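(* Let $G=(N,E)$ be a connected simple hypergraph on $N=[n]$. Then $\mathcal{A}_G$ is simplicial if and only if $\mathcal{A}_G$ is the connected subgraph arrangement of a cycle $C_3$ or of a path $P_n$; that is, if and only if, up to relabelling the vertices, $\mathcal{F}_{\mathcal{A}_G}=\mathcal{F}_{\mathcal{A}_{C_3}}$ (with $n=3$) or $\mathcal{F}_{\mathcal{A}_G}=\mathcal{F}_{\mathcal{A}_{P_n}}$, where $\mathcal{F}_{\mathcal{A}_G}$ denotes the set of all $I$ with $H_I\in\mathcal{A}_G$.
   Context: A simple hypergraph $G=(N,E)$ has vertex set $N=[n]=\{1,\dots,n\}$ ($n\ge 1$) and edge set $E\subseteq 2^N$. For $\emptyset\neq I\subseteq N$ the induced hypersubgraph is $G[I]=(I,\{e\in E\mid e\subseteq I\})$. Two vertices $u,v$ are adjacent via $e\in E$ if $\{u,v\}\subseteq e$. A $(u,v)$-walk of length $k\geq 0$ is a sequence $v_1e_1v_2e_2\dots e_kv_{k+1}$ with $v_1=u$, $v_{k+1}=v$, $e_i\in E$, and $v_i,v_{i+1}$ adjacent via $e_i$; it is a path if all its vertices and all its edges are distinct. $G$ is connected if for all $u,v\in N$ there is a $(u,v)$-path (a one-vertex hypergraph is connected). A simple graph is viewed as a hypergraph all of whose edges have two elements. $P_n$ is the path graph on $n$ vertices and $C_3$ is the triangle. For $\emptyset\ne I\subseteq N$ let $H_I=\ker\sum_{i\in I}x_i$. The connected hypersubgraph arrangement is $\mathcal{A}_G=\{H_I\mid \emptyset\neq I\subseteq N,\ G[I]\text{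 is connected}\}$, called a connected subgraph arrangement when $G$ is a simple graph. For simpliciality the hyperplanes are considered in $\mathbb{R}^n$. An arrangement $\mathcal{A}$ in $V=\mathbb{R}^n$ is simplicial if every connected component (chamber) $K$ of $V\setminus\bigcup_{H\in\mathcal{A}}H$ is an open simplicial cone, i.e. there are vectors $v_1,\dots,v_n\in V$ with $K=\{\sum_{i=1}^n a_iv_i\mid a_i>0\text{ for all }i\}$. *)

theory Defs
  imports "HOL-Analysis.Analysis"
begin

section \<open>Hypergraphs\<close>

text \<open>Edges may have any cardinality, as in an arbitrary set of subsets of the vertex set.\<close>

type_synonym 'a hypergraph = "'a set \<times> 'a set set"

abbreviation verts :: "'a hypergraph \<Rightarrow> 'a set" where "verts G \<equiv> fst G"

abbreviation edges :: "'a hypergraph \<Rightarrow> 'a set set" where "edges G \<equiv> snd G"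

definition simple_hypergraph :: "'a hypergraph \<Rightarrow> bool" where
  "simple_hypergraph G \<longleftrightarrow> finite (verts G) \<and> verts G \<noteq> {} \<and> edges G \<subseteq> Pow (verts G)"

definition induced :: "'a hypergraph \<Rightarrow> 'a set \<Rightarrow> 'a hypergraph" where
  "induced G I = (I, {e \<in> edges G. e \<subseteq> I})"

text \<open>A walk \<open>v\<^sub>1 e\<^sub>1 v\<^sub>2 \<dots> e\<^sub>k v\<^sub>k\<^sub>+\<^sub>1\<close> is given by its list of vertices (of length \<open>k + 1\<close>)
  and its list of edges (of length \<open>k\<close>).\<close>

definition adjacent_via :: "'a \<Rightarrow> 'a \<Rightarrow> 'a set \<Rightarrow> bool" where
  "adjacent_via u v e \<longleftrightarrow> {u, v} \<subseteq> e"

definition is_walk :: "'a hypergraph \<Rightarrow> 'a \<Rightarrow> 'a \<Rightarrow> 'a list \<Rightarrow> 'a set list \<Rightarrow> bool" where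
  "is_walk G u v vs es \<longleftrightarrow>
     length vs = Suc (length es) \<and> hd vs = u \<and> last vs = v \<and>
     set vs \<subseteq> verts G \<and> set es \<subseteq> edges G \<and>
     (\<forall>i < length es. adjacent_via (vs ! i) (vs ! Suc i) (es ! i))"

definition is_path :: "'a hypergraph \<Rightarrow> 'a \<Rightarrow> 'a \<Rightarrow> 'a list \<Rightarrow> 'a set list \<Rightarrow> bool" where
  "is_path G u v vs es \<longleftrightarrow> is_walk G u v vs es \<and> distinct vs \<and> distinct es"

definition hypergraph_connected :: "'a hypergraph \<Rightarrow> bool" where
  "hypergraph_connected G \<longleftrightarrow> (\<forall>u \<in> verts G. \<forall>v \<in> verts G. \<exists>vs es. is_path G u v vs es)"

definition path_graph :: "nat \<Rightarrow> nat hypergraph" where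
  "path_graph n = ({1..n}, {{i, i + 1} | i. 1 \<le> i \<and> i < n})"

definition C3 :: "nat hypergraph" where
  "C3 = ({1, 2, 3}, {{1, 2}, {2, 3}, {1, 3}})"

definition relabel :: "('a \<Rightarrow> 'b) \<Rightarrow> 'a hypergraph \<Rightarrow> 'b hypergraph" where
  "relabel f G = (f ` verts G, (\<lambda>e. f ` e) ` edges G)"

section \<open>Connected hypersubgraph arrangements\<close>

text \<open>The ground type \<open>'n\<close> serves as the vertex set \<open>[n]\<close>, where \<open>n = CARD('n)\<close>,
  so that \<open>real ^ 'n\<close> is the ambient space with one coordinate per vertex.\<close>

definition hyperplane :: "'n::finite set \<Rightarrow> (real ^ 'n) set" where
  "hyperplane I = {x. (\<Sum>i\<in>I. x $ i) = 0}"

definition hypersubgraph_arrangement :: "'n::finite hypergraph \<Rightarrow> (real ^ 'n) set set" where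
  "hypersubgraph_arrangement G =
     {hyperplane I | I. I \<noteq> {} \<and> I \<subseteq> verts G \<and> hypergraph_connected (induced G I)}"

text \<open>The index family of an arrangement; \<open>I = {}\<close> is excluded because \<open>hyperplane {}\<close> is the
  whole space.\<close>

definition index_family :: "(real ^ 'n::finite) set set \<Rightarrow> 'n set set" where
  "index_family \<A> = {I. I \<noteq> {} \<and> hyperplane I \<in> \<A>}"

section \<open>Simplicial arrangements\<close>

definition chambers :: "(real ^ 'n::finite) set set \<Rightarrow> (real ^ 'n) set set" where
  "chambers \<A> = components (UNIV - \<Union>\<A>)"

text \<open>The type \<open>'n\<close> also indexes the \<open>n\<close> generators of a cone.\<close>

definition open_simplicial_cone :: "(real ^ 'n::finite) set \<Rightarrow> bool" where
  "open_simplicial_cone K \<longleftrightarrow>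
     (\<exists>v :: 'n \<Rightarrow> real ^ 'n. K = {\<Sum>i\<in>UNIV. a i *\<^sub>R v i | a. \<forall>i. a i > 0})"

definition simplicial_arrangement :: "(real ^ 'n::finite) set set \<Rightarrow> bool" where
  "simplicial_arrangement \<A> \<longleftrightarrow> (\<forall>K \<in> chambers \<A>. open_simplicial_cone K)"

end

theory Submission
  imports Defs
begin

text \<open>
  The arrangement depends only on the family \<open>F\<close> of connected vertex sets. This family contains the
  one-vertex sets and is closed under unions of members that meet, and it contains the whole vertex set.
  A chamber is the set of points at which all the sums indexed by \<open>F\<close> have prescribed signs.

  The walls of a simplicial chamber are dual to its generators, hence linearly independent. So the
  arrangement is not simplicial as soon as some chamber has walls that satisfy a nontrivial linear relation.
  Such chambers are found near special points \<open>p\<close>, where only the hyperplanes through \<open>p\<close> count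
  (\<open>wall_sums_independent\<close>). Three relations suffice:

  \<^item> If \<open>J\<close> is a minimal member properly containing a member \<open>C\<close> and has at least two more
    vertices, then the sum over \<open>J\<close> and the coordinates in \<open>J\<close> are dependent walls. In the simplicial
    case members therefore grow by single vertices (\<open>simplicial_imp_accessible\<close>). This forces \<open>F\<close> to
    be the family of connected sets of the graph formed by its two-element members.
  \<^item> At a vertex \<open>c\<close> with neighbours \<open>a\<close>, \<open>b\<close>, \<open>d\<close>, the relation \<open>abc + cd = acd + bc\<close> holds among four walls
    (\<open>simplicial_imp_claw_free\<close>).
  \<^item> On a cycle cut into four arcs \<open>A\<close>, \<open>B\<close>, \<open>C\<close>, \<open>D\<close>, the relation \<open>AB + CD = BC + DA\<close> holds among four walls
    (\<open>simplicial_imp_no_four_cycle\<close>).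

  A connected graph without vertices of degree three or more has a Hamiltonian path, and the only possible
  further edge closes it to a cycle; cycles with four or more vertices are excluded, so only paths and the triangle
  remain (\<open>simplicial_imp_path_or_C3\<close>).

  Conversely, a chamber that is cut out by \<open>n\<close> of its inequalities is simplicial
  (\<open>simplicial_arrangementI\<close>). For the path, partial sums turn the arrangement into the braid arrangement, whose
  chambers are the orders of \<open>n + 1\<close> numbers; such an order is given by its \<open>n\<close> consecutive comparisons. For
  the triangle, a short case distinction on signs exhibits three walls of each chamber.
\<close>

section \<open>Chambers and their walls\<close>

definition coord_sum :: "'n::finite set \<Rightarrow> real ^ 'n \<Rightarrow> real" where
  "coord_sum I x = (\<Sum>i\<in>I. x $ i)"

text \<open>For \<open>x\<close> off all hyperplanes this is the chamber of \<open>x\<close>: the points at which every sum indexed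
by \<open>F\<close> has the sign that it has at \<open>x\<close>. Comparing signs through products avoids naming them.\<close>

definition cell :: "'n::finite set set \<Rightarrow> real ^ 'n \<Rightarrow> (real ^ 'n) set" where
  "cell F x = {y. \<forall>I\<in>F. 0 < coord_sum I x * coord_sum I y}"

lemma linear_coord_sum: "linear (coord_sum I)"
  unfolding coord_sum_def
  by (auto intro!: linearI simp: sum.distrib sum_distrib_left)

lemmas coord_sum_linear_simps =
  linear_add[OF linear_coord_sum] linear_diff[OF linear_coord_sum]
  linear_cmul[OF linear_coord_sum] linear_sum[OF linear_coord_sum]
  linear_0[OF linear_coord_sum] linear_neg[OF linear_coord_sum]

lemma continuous_on_coord_sum: "continuous_on S (coord_sum I)"
  by (simp add: linear_continuous_on linear_conv_bounded_linear[symmetric] linear_coord_sum)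

lemma coord_sum_singleton [simp]: "coord_sum {i} x = x $ i"
  by (simp add: coord_sum_def)

lemma hyperplane_eq: "hyperplane I = {x. coord_sum I x = 0}"
  by (simp add: hyperplane_def coord_sum_def)

lemma convex_cell:
  fixes x :: "real ^ 'n::finite"
  shows "convex (cell F x)"
proof (rule convexI)
  fix y z :: "real ^ 'n" and u v :: real
  assume y: "y \<in> cell F x" and z: "z \<in> cell F x" and uv: "0 \<le> u" "0 \<le> v" "u + v = 1"
  show "u *\<^sub>R y + v *\<^sub>R z \<in> cell F x"
    unfolding cell_def
  proof (intro CollectI ballI)
    fix I assume "I \<in> F"
    then have p: "0 < coord_sum I x * coord_sum I y" "0 < coord_sum I x * coord_sum I z"
      using y z by (auto simp: cell_def)
    have "coord_sum I x * coord_sum I (u *\<^sub>R y + v *\<^sub>R z) =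
        u * (coord_sum I x * coord_sum I y) + v * (coord_sum I x * coord_sum I z)"
      by (simp add: coord_sum_linear_simps algebra_simps)
    also have "\<dots> > 0"
    proof (cases "u = 0")
      case False
      then have "0 < u * (coord_sum I x * coord_sum I y)" using uv p by simp
      moreover have "0 \<le> v * (coord_sum I x * coord_sum I z)" using uv p by simp
      ultimately show ?thesis by linarith
    qed (use uv p in auto)
    finally show "0 < coord_sum I x * coord_sum I (u *\<^sub>R y + v *\<^sub>R z)" .
  qed
qed

lemma connected_nonzero_same_sign:
  assumes "connected T" "x \<in> T" "y \<in> T" "\<forall>z\<in>T. coord_sum I z \<noteq> 0"
  shows "0 < coord_sum I x * coord_sum I y"
proof -
  have "connected (coord_sum I ` T)"
    by (rule connected_continuous_image[OF continuous_on_coord_sum assms(1)])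
  then have "is_interval (coord_sum I ` T)" by (simp add: is_interval_connected_1)
  then have mid: "\<And>a b c. a \<in> coord_sum I ` T \<Longrightarrow> b \<in> coord_sum I ` T \<Longrightarrow> a \<le> c \<Longrightarrow> c \<le> b \<Longrightarrow>
      c \<in> coord_sum I ` T"
    by (meson is_interval_1)
  have nz: "0 \<notin> coord_sum I ` T" using assms(4) by auto
  have "\<not> (coord_sum I x \<le> 0 \<and> 0 \<le> coord_sum I y)" "\<not> (coord_sum I y \<le> 0 \<and> 0 \<le> coord_sum I x)"
    using mid nz assms(2,3) by blast+
  then show ?thesis by (auto simp: zero_less_mult_iff)
qed

lemma chambers_hyperplanes:
  fixes F :: "'n::finite set set"
  shows "chambers (hyperplane ` F) = cell F ` {x. \<forall>I\<in>F. coord_sum I x \<noteq> 0}"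
proof -
  define U where "U = {x :: real ^ 'n. \<forall>I\<in>F. coord_sum I x \<noteq> 0}"
  have U: "UNIV - \<Union>(hyperplane ` F) = U"
    by (auto simp: U_def hyperplane_eq)
  have "connected_component_set U x = cell F x" if x: "x \<in> U" for x
  proof
    show "connected_component_set U x \<subseteq> cell F x"
    proof
      fix y assume "y \<in> connected_component_set U x"
      then obtain T where T: "connected T" "T \<subseteq> U" "x \<in> T" "y \<in> T"
        by (auto simp: connected_component_def)
      then show "y \<in> cell F x"
        unfolding cell_def U_def using connected_nonzero_same_sign[OF T(1,3,4)] by blast
    qed
    show "cell F x \<subseteq> connected_component_set U x"
    proof (rule connected_component_maximal)
      show "x \<in> cell F x" using x by (auto simp: cell_def U_def zero_less_mult_iff linorder_neq_iff)
      show "connected (cell F x)" by (rule convex_connected[OF convex_cell])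
      show "cell F x \<subseteq> U" by (auto simp: cell_def U_def)
    qed
  qed
  then show ?thesis
    unfolding chambers_def U components_def U_def[symmetric] by auto
qed

text \<open>If \<open>n\<close> of the sums already determine the cell, they form a coordinate system in which the cell
is the open positive orthant. They are independent because a vector killed by all of them
spans a line inside the cell, and such a line would cross a coordinate hyperplane.\<close>

lemma open_simplicial_coneI:
  fixes x :: "real ^ 'n::finite" and B :: "'n \<Rightarrow> 'n set"
  assumes gen: "\<forall>I\<in>F. coord_sum I x \<noteq> 0" and single: "\<forall>i. {i} \<in> F"
    and B: "range B \<subseteq> F"
    and det: "\<And>y. (\<forall>i. 0 < coord_sum (B i) x * coord_sum (B i) y) \<Longrightarrow> y \<in> cell F x"
  shows "open_simplicial_cone (cell F x)"
proof -
  define g :: "real ^ 'n \<Rightarrow> real ^ 'n" where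
    "g y = (\<chi> i. coord_sum (B i) x * coord_sum (B i) y)" for y
  have lin: "linear g"
    unfolding g_def
    by (rule linearI) (auto simp: coord_sum_linear_simps vec_eq_iff algebra_simps)
  have "inj g"
  proof (subst linear_injective_0[OF lin], intro allI impI)
    fix y assume "g y = 0"
    then have B0: "coord_sum (B i) y = 0" for i
    proof -
      have "coord_sum (B i) x * coord_sum (B i) y = 0"
        using \<open>g y = 0\<close> by (simp add: g_def vec_eq_iff)
      moreover have "coord_sum (B i) x \<noteq> 0" using gen B by blast
      ultimately show ?thesis by simp
    qed
    have line: "0 < coord_sum I x * (coord_sum I x + t * coord_sum I y)" if "I \<in> F" for I t
    proof -
      have "x + t *\<^sub>R y \<in> cell F x"
        using gen B by (intro det) (auto simp: coord_sum_linear_simps B0 zero_less_mult_iff linorder_neq_iff)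
      then show ?thesis using that by (auto simp: cell_def coord_sum_linear_simps)
    qed
    have "y $ i = 0" for i
    proof (rule ccontr)
      assume "y $ i \<noteq> 0"
      \<comment> \<open>This parameter is where the line meets the coordinate hyperplane.\<close>
      with line[of "{i}" "- (x $ i) / y $ i"] single show False by simp
    qed
    then show "y = 0" by (simp add: vec_eq_iff)
  qed
  then have "surj g" using lin linear_injective_imp_surjective by blast
  define v where "v i = inv g (axis i 1)" for i
  have v: "g (v i) = axis i 1" for i
    unfolding v_def by (rule surj_f_inv_f[OF \<open>surj g\<close>])
  have gsum: "g (\<Sum>i\<in>UNIV. a i *\<^sub>R v i) = (\<chi> i. a i)" for a
    by (simp add: linear_sum[OF lin] linear_cmul[OF lin] v o_def vec_eq_iff axis_def if_distrib cong: if_cong)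
  have "cell F x = {\<Sum>i\<in>UNIV. a i *\<^sub>R v i | a. \<forall>i. a i > 0}"
  proof safe
    fix y assume y: "y \<in> cell F x"
    have "y = (\<Sum>i\<in>UNIV. (g y $ i) *\<^sub>R v i)"
      using \<open>inj g\<close> by (rule injD) (simp add: gsum)
    moreover have "\<forall>i. g y $ i > 0" using y B by (auto simp: g_def cell_def)
    ultimately show "\<exists>a. y = (\<Sum>i\<in>UNIV. a i *\<^sub>R v i) \<and> (\<forall>i. a i > 0)" by blast
  next
    fix a :: "'n \<Rightarrow> real" assume a: "\<forall>i. a i > 0"
    have "coord_sum (B i) x * coord_sum (B i) (\<Sum>i\<in>UNIV. a i *\<^sub>R v i) = a i" for i
      using arg_cong[OF gsum[of a], of "\<lambda>z. z $ i"] unfolding g_def vec_lambda_beta .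
    then show "(\<Sum>i\<in>UNIV. a i *\<^sub>R v i) \<in> cell F x" using a by (intro det) simp
  qed
  then show ?thesis unfolding open_simplicial_cone_def by blast
qed

text \<open>The criterion used for the two simplicial families. Listing a set \<open>B\<close> of at most \<open>n\<close> walls is
more convenient than a family indexed by the coordinates; repetitions fill up the family.\<close>

lemma simplicial_arrangementI:
  assumes single: "\<forall>i. {i} \<in> F"
    and cells: "\<And>x :: real ^ 'n::finite. \<forall>I\<in>F. coord_sum I x \<noteq> 0 \<Longrightarrow>
      \<exists>B\<subseteq>F. card B \<le> CARD('n) \<and>
        (\<forall>y. (\<forall>J\<in>B. 0 < coord_sum J x * coord_sum J y) \<longrightarrow> y \<in> cell F x)"
  shows "simplicial_arrangement (hyperplane ` F)"
  unfolding simplicial_arrangement_def chambers_hyperplanes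
proof safe
  fix x :: "real ^ 'n" assume gen: "\<forall>I\<in>F. coord_sum I x \<noteq> 0"
  obtain B where B: "B \<subseteq> F" "card B \<le> CARD('n)"
    and det: "\<And>y. \<forall>J\<in>B. 0 < coord_sum J x * coord_sum J y \<Longrightarrow> y \<in> cell F x"
    using cells[OF gen] by blast
  have "B \<noteq> {}"
    using det[of 0] single by (auto simp: cell_def coord_sum_linear_simps)
  obtain h where h: "h ` B \<subseteq> (UNIV :: 'n set)" "inj_on h B"
    using card_le_inj[of B "UNIV :: 'n set"] B(2) by auto
  define b where "b = inv_into B h"
  obtain J0 where J0: "J0 \<in> B" using \<open>B \<noteq> {}\<close> by blast
  define b' where "b' i = (if i \<in> h ` B then b i else J0)" for i
  have "range b' = B"
  proof
    show "range b' \<subseteq> B" using J0 by (auto simp: b'_def b_def inv_into_into)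
    have "b' (h J) = J" if "J \<in> B" for J
      using h(2) that by (simp add: b'_def b_def)
    then show "B \<subseteq> range b'" by (metis rangeI subsetI)
  qed
  then show "open_simplicial_cone (cell F x)"
    using gen single B(1) by (intro open_simplicial_coneI[of F x b'] det) blast+
qed

text \<open>A short step from \<open>p\<close> in any direction can alter the signs of only those sums that vanish at \<open>p\<close>.
So the chambers adjacent to \<open>p\<close> can be studied with the hyperplanes through \<open>p\<close> alone.\<close>

lemma eventually_sign_stable:
  fixes p :: "real ^ 'n::finite"
  shows "eventually (\<lambda>t. 0 < t \<and> (\<forall>I. coord_sum I p \<noteq> 0 \<longrightarrow>
    0 < coord_sum I p * coord_sum I (p + t *\<^sub>R y))) (at_right 0)"
proof -
  have "eventually (\<lambda>t. \<forall>I\<in>{I. coord_sum I p \<noteq> 0}.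
      0 < coord_sum I p * coord_sum I (p + t *\<^sub>R y)) (at_right 0)"
  proof (rule eventually_ball_finite, simp, rule ballI)
    fix I assume I: "I \<in> {I. coord_sum I p \<noteq> 0}"
    have "((\<lambda>t. coord_sum I p * coord_sum I (p + t *\<^sub>R y)) \<longlongrightarrow>
        coord_sum I p * (coord_sum I p + 0 * coord_sum I y)) (at_right 0)"
      unfolding coord_sum_linear_simps by (auto intro!: tendsto_eq_intros)
    moreover have "0 < coord_sum I p * (coord_sum I p + 0 * coord_sum I y)"
      using I by (auto simp: zero_less_mult_iff linorder_neq_iff)
    ultimately show "eventually (\<lambda>t. 0 < coord_sum I p * coord_sum I (p + t *\<^sub>R y)) (at_right 0)"
      by (rule order_tendstoD(1))
  qed
  then show ?thesis
    by (auto intro!: eventually_conj simp: eventually_at_right_less elim: eventually_mono)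
qed

text \<open>The walls of a simplicial chamber with generators \<open>v\<close> are dual to the generators. The point
\<open>\<Sum>j\<noteq>i. v j\<close> lies on the boundary of the cone but not in it, so some hyperplane of the arrangement
passes through it; as its sum has a constant sign on the cone, it vanishes at every \<open>v j\<close> with
\<open>j \<noteq> i\<close>. Hence each facet spans a hyperplane of the arrangement.\<close>

lemma open_simplicial_cone_walls:
  fixes x :: "real ^ 'n::finite"
  assumes cone: "open_simplicial_cone (cell F x)" and gen: "\<forall>I\<in>F. coord_sum I x \<noteq> 0"
  obtains B v where "range B \<subseteq> F"
    and "\<And>i j. coord_sum (B i) (v j) = 0 \<longleftrightarrow> i \<noteq> (j :: 'n)"
    and "\<And>y. (\<forall>i. 0 < coord_sum (B i) x * coord_sum (B i) y) \<Longrightarrow> y \<in> cell F x"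
proof -
  obtain v :: "'n \<Rightarrow> real ^ 'n" where v: "cell F x = {\<Sum>i\<in>UNIV. a i *\<^sub>R v i | a. \<forall>i. a i > 0}"
    using cone by (auto simp: open_simplicial_cone_def)
  define f :: "real ^ 'n \<Rightarrow> real ^ 'n" where "f a = (\<Sum>i\<in>UNIV. a $ i *\<^sub>R v i)" for a
  have lin: "linear f"
    unfolding f_def by (rule linearI) (auto simp: algebra_simps sum.distrib scaleR_sum_right)
  have pos: "f a \<in> cell F x" if "\<forall>i. a $ i > 0" for a
    using that unfolding v f_def by blast
  have rep: "\<exists>a. y = f a \<and> (\<forall>i. a $ i > 0)" if y: "y \<in> cell F x" for y
  proof -
    obtain a where "y = (\<Sum>i\<in>UNIV. a i *\<^sub>R v i)" "\<forall>i. a i > 0" using y unfolding v by blast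
    then show ?thesis by (intro exI[of _ "\<chi> i. a i"]) (auto simp: f_def)
  qed
  have "surj f"
  proof -
    have sub: "subspace (range f)"
      using lin by (simp add: linear_subspace_image)
    have xc: "x \<in> cell F x"
      using gen by (auto simp: cell_def zero_less_mult_iff linorder_neq_iff)
    have "y \<in> range f" for y
    proof -
      obtain t :: real where t: "t > 0"
          "\<And>I. coord_sum I x \<noteq> 0 \<Longrightarrow> 0 < coord_sum I x * coord_sum I (x + t *\<^sub>R y)"
        using eventually_happens[OF eventually_sign_stable[of x y]] trivial_limit_at_right_real by blast
      then have "x + t *\<^sub>R y \<in> cell F x" using gen by (simp add: cell_def)
      then have "x + t *\<^sub>R y \<in> range f" "x \<in> range f"
        using rep rep[OF xc] by blast+
      then have "(1 / t) *\<^sub>R ((x + t *\<^sub>R y) - x) \<in> range f"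
        by (intro subspace_scale[OF sub] subspace_diff[OF sub])
      then show ?thesis using t(1) by simp
    qed
    then show ?thesis by blast
  qed
  then have "inj f" using lin linear_surjective_imp_injective by blast
  \<comment> \<open>The signs of the open cone persist weakly on its closure: shift all coefficients by \<open>t > 0\<close>
      and let \<open>t\<close> tend to \<open>0\<close>.\<close>
  have nonneg: "0 \<le> coord_sum I x * coord_sum I (f a)" if "\<forall>i. a $ i \<ge> 0" "I \<in> F" for a I
  proof (rule tendsto_lowerbound)
    show "((\<lambda>t. coord_sum I x * coord_sum I (f (a + t *\<^sub>R 1))) \<longlongrightarrow> coord_sum I x * coord_sum I (f a)) (at_right 0)"
      unfolding linear_add[OF lin] linear_cmul[OF lin] coord_sum_linear_simps
      by (auto intro!: tendsto_eq_intros)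
    have "f (a + t *\<^sub>R 1) \<in> cell F x" if "t > 0" for t
      using \<open>\<forall>i. a $ i \<ge> 0\<close> that by (intro pos) (simp add: add_nonneg_pos)
    then have "0 < coord_sum I x * coord_sum I (f (a + t *\<^sub>R 1))" if "t > 0" for t
      using that \<open>I \<in> F\<close> unfolding cell_def by blast
    then have "\<And>t. t > 0 \<Longrightarrow> 0 \<le> coord_sum I x * coord_sum I (f (a + t *\<^sub>R 1))"
      using less_imp_le by blast
    then show "\<forall>\<^sub>F t in at_right 0. 0 \<le> coord_sum I x * coord_sum I (f (a + t *\<^sub>R 1))"
      using eventually_at_right_less[of "0::real"] by (rule eventually_mono[rotated])
  qed simp
  have fax: "f (axis j 1) = v j" for j
    by (simp add: f_def axis_def if_distrib if_distribR sum.delta cong: if_cong)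
  have axis_nonneg: "\<forall>i. (axis j 1 :: real ^ 'n) $ i \<ge> 0" for j :: 'n
    by (simp add: axis_def)
  have facet: "\<exists>I\<in>F. \<forall>j. coord_sum I (v j) = 0 \<longleftrightarrow> i \<noteq> j" for i
  proof -
    define e :: "real ^ 'n" where "e = (\<chi> j. if j = i then 0 else 1)"
    have "f e \<notin> cell F x"
    proof
      assume "f e \<in> cell F x"
      then obtain a where "f e = f a" "\<forall>i. a $ i > 0" using rep by blast
      then have "e $ i > 0" using \<open>inj f\<close> by (metis injD)
      then show False by (simp add: e_def)
    qed
    then obtain I where I: "I \<in> F" "coord_sum I x * coord_sum I (f e) \<le> 0"
      by (auto simp: cell_def not_less)
    have vj: "0 \<le> coord_sum I x * coord_sum I (v j)" for j
      using nonneg[OF axis_nonneg I(1)] by (simp add: fax)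
    have "f e = (\<Sum>j\<in>UNIV - {i}. v j)"
      unfolding f_def e_def by (rule sum.mono_neutral_cong_right) auto
    then have "(\<Sum>j\<in>UNIV - {i}. coord_sum I x * coord_sum I (v j)) \<le> 0"
      using I(2) by (simp add: coord_sum_linear_simps sum_distrib_left)
    then have "(\<Sum>j\<in>UNIV - {i}. coord_sum I x * coord_sum I (v j)) = 0"
      using vj by (meson order_antisym sum_nonneg)
    then have "\<forall>j\<in>UNIV - {i}. coord_sum I x * coord_sum I (v j) = 0"
      by (subst (asm) sum_nonneg_eq_0_iff) (use vj in auto)
    then have 0: "coord_sum I (v j) = 0" if "j \<noteq> i" for j
      using gen I(1) that by auto
    have "coord_sum I (v i) \<noteq> 0"
    proof
      assume "coord_sum I (v i) = 0"
      then have "coord_sum I (v j) = 0" for j using 0 by (cases "j = i") auto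
      then have "coord_sum I (f a) = 0" for a
        by (simp add: f_def coord_sum_linear_simps)
      then show False using \<open>surj f\<close> gen I(1) by (metis surj_def)
    qed
    then show ?thesis using I(1) 0 by metis
  qed
  then obtain B where B: "\<And>i. B i \<in> F" "\<And>i j. coord_sum (B i) (v j) = 0 \<longleftrightarrow> i \<noteq> j"
    by metis
  have "y \<in> cell F x" if y: "\<forall>i. 0 < coord_sum (B i) x * coord_sum (B i) y" for y
  proof -
    obtain a where a: "y = f a" using \<open>surj f\<close> by (metis surj_def)
    have "a $ i > 0" for i
    proof -
      have "coord_sum (B i) y = (\<Sum>j\<in>UNIV. if j = i then a $ i * coord_sum (B i) (v i) else 0)"
        unfolding a f_def coord_sum_linear_simps
        by (intro sum.cong) (use B(2) in \<open>auto\<close>)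
      then have "coord_sum (B i) y = a $ i * coord_sum (B i) (v i)" by simp
      then have "0 < a $ i * (coord_sum (B i) x * coord_sum (B i) (v i))"
        using y by (metis mult.left_commute)
      moreover have "0 \<le> coord_sum (B i) x * coord_sum (B i) (v i)"
        using nonneg[OF axis_nonneg B(1)] by (simp add: fax)
      ultimately show ?thesis by (simp add: zero_less_mult_iff)
    qed
    then show ?thesis using pos a by blast
  qed
  with B that show ?thesis by blast
qed

text \<open>The obstruction behind the whole necessity proof. Consider the chamber entered from the
special point \<open>p\<close> in direction \<open>q\<close>. A sum \<open>J\<close> vanishing at \<open>p\<close> gives a wall of this chamber as soon as
some direction \<open>y\<close> gives \<open>J\<close>, and no other sum vanishing at \<open>p\<close>, the sign opposite to that in direction
\<open>q\<close>; hyperplanes that miss \<open>p\<close> do not interfere. The walls of a simplicial chamber are dual to a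
basis, so they cannot satisfy a nontrivial linear relation.\<close>

lemma wall_sums_independent:
  fixes p q :: "real ^ 'n::finite"
  assumes simplicial: "simplicial_arrangement (hyperplane ` F)"
    and q: "\<And>I. I \<in> F \<Longrightarrow> coord_sum I p = 0 \<Longrightarrow> coord_sum I q \<noteq> 0"
    and walls: "\<And>J. J \<in> W \<Longrightarrow> J \<in> F \<and> coord_sum J p = 0 \<and>
      (\<exists>y. coord_sum J q * coord_sum J y < 0 \<and>
        (\<forall>I\<in>F. coord_sum I p = 0 \<longrightarrow> I \<noteq> J \<longrightarrow> 0 < coord_sum I q * coord_sum I y))"
    and rel: "\<And>y. (\<Sum>J\<in>W. c J * coord_sum J y) = 0"
    and J: "J \<in> W"
  shows "c J = 0"
proof -
  have "\<exists>t>0. \<forall>I. coord_sum I p \<noteq> 0 \<longrightarrow> 0 < coord_sum I p * coord_sum I (p + t *\<^sub>R y)" for y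
    using eventually_happens[OF eventually_sign_stable] trivial_limit_at_right_real by blast
  then obtain \<delta> where \<delta>: "\<And>y. \<delta> y > 0"
    "\<And>y I. coord_sum I p \<noteq> 0 \<Longrightarrow> 0 < coord_sum I p * coord_sum I (p + \<delta> y *\<^sub>R y)"
    by metis
  define near where "near y = p + \<delta> y *\<^sub>R y" for y
  define x where "x = near q"
  have off: "0 < coord_sum I x * coord_sum I (near y)" if "coord_sum I p \<noteq> 0" for I y
    using \<delta>(2)[OF that, of q] \<delta>(2)[OF that, of y]
    by (auto simp: x_def near_def zero_less_mult_iff)
  have on: "coord_sum I x * coord_sum I (near y) = (\<delta> q * \<delta> y) * (coord_sum I q * coord_sum I y)"
    if "coord_sum I p = 0" for I y
    using that by (simp add: x_def near_def coord_sum_linear_simps)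
  have gen: "\<forall>I\<in>F. coord_sum I x \<noteq> 0"
  proof
    fix I assume "I \<in> F"
    show "coord_sum I x \<noteq> 0"
    proof (cases "coord_sum I p = 0")
      case True
      then show ?thesis using q[OF \<open>I \<in> F\<close>] \<delta>(1)[of q] by (auto simp: x_def near_def coord_sum_linear_simps)
    next
      case False
      then show ?thesis using off[of I q] by auto
    qed
  qed
  then have "open_simplicial_cone (cell F x)"
    using simplicial unfolding simplicial_arrangement_def chambers_hyperplanes by blast
  then obtain B v where B: "range B \<subseteq> F"
    and dual: "\<And>i j. coord_sum (B i) (v j) = 0 \<longleftrightarrow> i \<noteq> (j :: 'n)"
    and det: "\<And>y. (\<forall>i. 0 < coord_sum (B i) x * coord_sum (B i) y) \<Longrightarrow> y \<in> cell F x"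
    using gen by (rule open_simplicial_cone_walls) blast
  \<comment> \<open>If \<open>J\<close> were not among the dual walls, \<open>near y\<close> would satisfy the inequalities that determine the
      cell of \<open>x\<close> and yet lie on the wrong side of \<open>J\<close>.\<close>
  have W: "W \<subseteq> range B"
  proof
    fix J assume "J \<in> W"
    then obtain y where J: "J \<in> F" "coord_sum J p = 0" "coord_sum J q * coord_sum J y < 0"
      and y: "\<forall>I\<in>F. coord_sum I p = 0 \<longrightarrow> I \<noteq> J \<longrightarrow> 0 < coord_sum I q * coord_sum I y"
      using walls by blast
    have others: "0 < coord_sum I x * coord_sum I (near y)" if "I \<in> F" "I \<noteq> J" for I
      using off[of I y] on[of I y] y that \<delta>(1) by (cases "coord_sum I p = 0") auto
    have "coord_sum J x * coord_sum J (near y) < 0"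
      using on[OF J(2)] J(3) \<delta>(1) by (simp add: mult_pos_neg)
    then have "near y \<notin> cell F x" using J(1) unfolding cell_def by fastforce
    then obtain i where "\<not> 0 < coord_sum (B i) x * coord_sum (B i) (near y)" using det by blast
    then have "B i = J" using others B by blast
    then show "J \<in> range B" by blast
  qed
  then obtain i where i: "J = B i" using J by blast
  have zero: "coord_sum J' (v i) = 0" if "J' \<in> W - {J}" for J'
    using that W i dual by blast
  have "(\<Sum>J'\<in>W. c J' * coord_sum J' (v i)) = c J * coord_sum J (v i)"
    using J zero by (subst sum.remove[of _ J]) auto
  then show ?thesis using rel[of "v i"] dual[of i i] i by simp
qed

section \<open>Families of connected sets\<close>

text \<open>The abstract properties of families of connected vertex sets on which the arguments rest. Such
families are the building sets known from nested set complexes.\<close>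

definition building_set :: "'a set set \<Rightarrow> bool" where
  "building_set F \<longleftrightarrow> (\<forall>i. {i} \<in> F) \<and> {} \<notin> F \<and>
     (\<forall>I\<in>F. \<forall>J\<in>F. I \<inter> J \<noteq> {} \<longrightarrow> I \<union> J \<in> F)"

lemma building_setD:
  assumes "building_set F"
  shows building_set_singleton: "{i} \<in> F"
    and building_set_nonempty: "I \<in> F \<Longrightarrow> I \<noteq> {}"
    and building_set_Un: "I \<in> F \<Longrightarrow> J \<in> F \<Longrightarrow> I \<inter> J \<noteq> {} \<Longrightarrow> I \<union> J \<in> F"
  using assms unfolding building_set_def by auto

definition connected_sets :: "'a hypergraph \<Rightarrow> 'a set set" where
  "connected_sets G = {I. I \<noteq> {} \<and> I \<subseteq> verts G \<and> hypergraph_connected (induced G I)}"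

lemma hypersubgraph_arrangement_eq: "hypersubgraph_arrangement G = hyperplane ` connected_sets G"
  by (auto simp: hypersubgraph_arrangement_def connected_sets_def)

lemma index_family_eq_iff:
  "index_family (hypersubgraph_arrangement G) = index_family (hypersubgraph_arrangement H) \<longleftrightarrow>
   hypersubgraph_arrangement G = hypersubgraph_arrangement H"
proof -
  have "hypersubgraph_arrangement G = hyperplane ` index_family (hypersubgraph_arrangement G)" for G :: "'a hypergraph"
    by (auto simp: hypersubgraph_arrangement_def index_family_def)
  then show ?thesis by metis
qed

text \<open>Appending an edge to a path can repeat an edge or a vertex. Cutting the path at its first
vertex on the new edge \<open>e\<close> avoids both: no earlier edge equals \<open>e\<close>, since its first end would
be an earlier vertex on \<open>e\<close>.\<close>

lemma path_extend:
  assumes path: "is_path G u v vs es" and e: "e \<in> edges G" "v \<in> e" "w \<in> e" "w \<in> verts G"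
  shows "\<exists>vs es. is_path G u w vs es"
proof -
  define k where "k = (LEAST k. k < length vs \<and> vs ! k \<in> e)"
  have len: "length vs = Suc (length es)" and hd: "hd vs = u" and last: "last vs = v"
    and vs: "set vs \<subseteq> verts G" and es: "set es \<subseteq> edges G" and dist: "distinct vs" "distinct es"
    and adj: "\<And>i. i < length es \<Longrightarrow> {vs ! i, vs ! Suc i} \<subseteq> es ! i"
    using path by (auto simp: is_path_def is_walk_def adjacent_via_def)
  have ne: "vs \<noteq> []" using len by auto
  have "length vs - 1 < length vs \<and> vs ! (length vs - 1) \<in> e"
    using last e(2) ne by (auto simp: last_conv_nth)
  then have k: "k < length vs" "vs ! k \<in> e"
    unfolding k_def by (rule LeastI2; blast)+
  have first: "vs ! i \<notin> e" if "i < k" for i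
    using not_less_Least[of i "\<lambda>k. k < length vs \<and> vs ! k \<in> e"] that k(1) by (auto simp: k_def)
  have lk: "k \<le> length es" using k(1) len by simp
  have trunc: "is_path G u (vs ! k) (take (Suc k) vs) (take k es)"
    using len lk hd ne vs es dist adj k(1) set_take_subset[of "Suc k" vs] set_take_subset[of k es]
    by (auto simp: is_path_def is_walk_def adjacent_via_def hd_take last_conv_nth)
  show ?thesis
  proof (cases "w \<in> set (take (Suc k) vs)")
    case True
    then obtain i where "i \<le> k" "vs ! i = w" by (auto simp: in_set_conv_nth less_Suc_eq_le)
    then have "w = vs ! k" using first e(3) by (cases "i < k") auto
    then show ?thesis using trunc by blast
  next
    case False
    have "e \<notin> set (take k es)"
    proof
      assume "e \<in> set (take k es)"
      then obtain i where "i < k" "i < length es" "es ! i = e" by (auto simp: in_set_conv_nth)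
      then show False using adj[of i] first[of i] by auto
    qed
    moreover have "{(take (Suc k) vs @ [w]) ! i, (take (Suc k) vs @ [w]) ! Suc i} \<subseteq> (take k es @ [e]) ! i"
      if "i < Suc k" for i
    proof (cases "i = k")
      case True
      then show ?thesis using k lk e len by (simp add: nth_append)
    next
      case False
      then show ?thesis using that lk len adj[of i] by (auto simp: nth_append)
    qed
    ultimately have "is_path G u w (take (Suc k) vs @ [w]) (take k es @ [e])"
      using False trunc e lk len k(1) ne
      by (auto simp: is_path_def is_walk_def adjacent_via_def)
    then show ?thesis by blast
  qed
qed

lemma walk_crosses_cut:
  assumes "is_walk G u v vs es" "u \<in> S" "v \<notin> S"
  shows "\<exists>e\<in>edges G. e \<inter> S \<noteq> {} \<and> \<not> e \<subseteq> S"
proof -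
  define k where "k = (LEAST k. k < length vs \<and> vs ! k \<notin> S)"
  have len: "length vs = Suc (length es)" and hd: "hd vs = u" and last: "last vs = v"
    and es: "set es \<subseteq> edges G"
    and adj: "\<And>i. i < length es \<Longrightarrow> {vs ! i, vs ! Suc i} \<subseteq> es ! i"
    using assms(1) by (auto simp: is_walk_def adjacent_via_def)
  have ne: "vs \<noteq> []" using len by auto
  have "length vs - 1 < length vs \<and> vs ! (length vs - 1) \<notin> S"
    using last assms(3) ne by (auto simp: last_conv_nth)
  then have k: "k < length vs" "vs ! k \<notin> S"
    unfolding k_def by (rule LeastI2; blast)+
  have "k \<noteq> 0" using k(2) hd ne assms(2) by (metis hd_conv_nth)
  then obtain j where j: "k = Suc j" by (cases k) auto
  have "vs ! j \<in> S"
    using not_less_Least[of j "\<lambda>k. k < length vs \<and> vs ! k \<notin> S"] k(1) j by (auto simp: k_def)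
  moreover have "j < length es" using k(1) j len by simp
  ultimately have "es ! j \<in> edges G" "vs ! j \<in> es ! j" "vs ! k \<in> es ! j"
    using adj[of j] es nth_mem[of j es] j by auto
  then show ?thesis using \<open>vs ! j \<in> S\<close> k(2) by blast
qed

text \<open>Connectedness by paths is replaced once and for all by the absence of cuts: an edge must
leave the set of vertices reachable from a given one unless that set is everything.\<close>

lemma connected_iff_no_cut:
  assumes sub: "edges G \<subseteq> Pow (verts G)"
  shows "hypergraph_connected G \<longleftrightarrow>
     (\<forall>S. S \<noteq> {} \<and> S \<subset> verts G \<longrightarrow> (\<exists>e\<in>edges G. e \<inter> S \<noteq> {} \<and> \<not> e \<subseteq> S))"
    (is "_ \<longleftrightarrow> ?cut")
proof (intro iffI allI impI)
  fix S assume conn: "hypergraph_connected G" and "S \<noteq> {} \<and> S \<subset> verts G"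
  then have S: "S \<noteq> {}" "S \<subset> verts G" by auto
  then obtain u v where uv: "u \<in> S" "u \<in> verts G" "v \<in> verts G" "v \<notin> S" by blast
  then obtain vs es where "is_path G u v vs es"
    using conn unfolding hypergraph_connected_def by blast
  then have "is_walk G u v vs es" unfolding is_path_def by blast
  then show "\<exists>e\<in>edges G. e \<inter> S \<noteq> {} \<and> \<not> e \<subseteq> S"
    using uv(1,4) by (rule walk_crosses_cut)
next
  assume cut: ?cut
  show "hypergraph_connected G"
    unfolding hypergraph_connected_def
  proof (intro ballI)
    fix u v assume u: "u \<in> verts G" and v: "v \<in> verts G"
    define R where "R = {w \<in> verts G. \<exists>vs es. is_path G u w vs es}"
    have "is_path G u u [u] []" using u by (auto simp: is_path_def is_walk_def)
    then have "R \<noteq> {}" using u by (auto simp: R_def)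
    have "R = verts G"
    proof (rule ccontr)
      assume "R \<noteq> verts G"
      then have "R \<subset> verts G" by (auto simp: R_def)
      then obtain e where e: "e \<in> edges G" "e \<inter> R \<noteq> {}" "\<not> e \<subseteq> R"
        using cut \<open>R \<noteq> {}\<close> by blast
      then obtain a b where ab: "a \<in> e" "a \<in> R" "b \<in> e" "b \<notin> R" by blast
      then have "b \<in> verts G" using e(1) sub by blast
      moreover obtain vs es where path: "is_path G u a vs es" using ab(2) by (auto simp: R_def)
      ultimately have "b \<in> R" using path_extend[OF path e(1) ab(1,3)] by (simp add: R_def)
      then show False using ab by blast
    qed
    then show "\<exists>vs es. is_path G u v vs es" using v by (auto simp: R_def)
  qed
qed

lemma mem_connected_sets_iff:
  "I \<in> connected_sets G \<longleftrightarrow> I \<noteq> {} \<and> I \<subseteq> verts G \<and>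
     (\<forall>S. S \<noteq> {} \<and> S \<subset> I \<longrightarrow> (\<exists>e\<in>edges G. e \<subseteq> I \<and> e \<inter> S \<noteq> {} \<and> \<not> e \<subseteq> S))"
proof -
  have "edges (induced G I) \<subseteq> Pow (verts (induced G I))" by (auto simp: induced_def)
  then have "hypergraph_connected (induced G I) \<longleftrightarrow>
      (\<forall>S. S \<noteq> {} \<and> S \<subset> I \<longrightarrow> (\<exists>e\<in>{e \<in> edges G. e \<subseteq> I}. e \<inter> S \<noteq> {} \<and> \<not> e \<subseteq> S))"
    by (subst connected_iff_no_cut) (simp_all only: induced_def fst_conv snd_conv)
  then show ?thesis
    unfolding connected_sets_def mem_Collect_eq by (simp only: bex_simps) (simp only: mem_Collect_eq Bex_def conj_assoc)
qed

lemma connected_sets_edge_across_cut: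
  assumes "I \<in> connected_sets G" "S \<noteq> {}" "S \<subset> I"
  obtains e where "e \<in> edges G" "e \<subseteq> I" "e \<inter> S \<noteq> {}" "\<not> e \<subseteq> S"
  using assms unfolding mem_connected_sets_iff by meson

lemma building_set_connected_sets:
  assumes "verts G = UNIV"
  shows "building_set (connected_sets G)"
  unfolding building_set_def
proof (intro conjI allI ballI impI)
  fix i :: 'a
  have "\<not> (S \<noteq> {} \<and> S \<subset> {i})" for S by (auto simp: psubset_eq subset_singleton_iff)
  then show "{i} \<in> connected_sets G"
    unfolding mem_connected_sets_iff assms by (intro conjI) (simp, simp, metis)
next
  show "{} \<notin> connected_sets G" by (simp add: mem_connected_sets_iff)
next
  fix I J assume I: "I \<in> connected_sets G" and J: "J \<in> connected_sets G" and meet: "I \<inter> J \<noteq> {}"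
  have "\<exists>e\<in>edges G. e \<subseteq> I \<union> J \<and> e \<inter> S \<noteq> {} \<and> \<not> e \<subseteq> S"
    if S: "S \<noteq> {}" "S \<subset> I \<union> J" for S
  proof -
    have part: "?thesis" if K: "K \<in> connected_sets G" "K \<subseteq> I \<union> J" "K \<inter> S \<noteq> {}" "\<not> K \<subseteq> S" for K
    proof -
      have "K \<inter> S \<noteq> {}" "K \<inter> S \<subset> K" using K by auto
      then obtain e where "e \<in> edges G" "e \<subseteq> K" "e \<inter> (K \<inter> S) \<noteq> {}" "\<not> e \<subseteq> K \<inter> S"
        using connected_sets_edge_across_cut[OF K(1), of "K \<inter> S"] by metis
      then show ?thesis using K(2) by blast
    qed
    have "(I \<inter> S \<noteq> {} \<and> \<not> I \<subseteq> S) \<or> (J \<inter> S \<noteq> {} \<and> \<not> J \<subseteq> S)"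
      using S meet by blast
    then show ?thesis using part[OF I] part[OF J] by blast
  qed
  moreover have "I \<union> J \<noteq> {}" using meet by blast
  ultimately show "I \<union> J \<in> connected_sets G"
    unfolding mem_connected_sets_iff[of "I \<union> J"] assms by blast
qed

text \<open>Among the building sets on a finite set, this property characterizes the families of connected sets of graphs.\<close>

definition accessible :: "'a set set \<Rightarrow> bool" where
  "accessible F \<longleftrightarrow> (\<forall>C\<in>F. \<forall>I\<in>F. C \<subset> I \<longrightarrow> (\<exists>j\<in>I - C. insert j C \<in> F))"

text \<open>Take a largest member \<open>C\<close> inside \<open>S\<close> and add one vertex \<open>j\<close> of \<open>I\<close>; it lies outside \<open>S\<close>. Growing \<open>{j}\<close>
inside \<open>insert j C\<close> by one vertex then gives a pair that joins \<open>j\<close> to \<open>C\<close>.\<close>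

lemma accessible_imp_pair_across_cut:
  fixes F :: "'a::finite set set"
  assumes F: "building_set F" "accessible F" and I: "I \<in> F" and S: "S \<noteq> {}" "S \<subset> I"
  shows "\<exists>a\<in>S. \<exists>b\<in>I - S. {a, b} \<in> F"
proof -
  obtain s where "s \<in> S" using S by blast
  then have "{s} \<in> {C \<in> F. C \<subseteq> S}" using F(1) by (auto simp: building_set_def)
  then obtain C where C: "C \<in> F" "C \<subseteq> S" and max: "\<And>D. D \<in> F \<Longrightarrow> D \<subseteq> S \<Longrightarrow> C \<subseteq> D \<Longrightarrow> C = D"
    using finite_has_maximal2[of "{C \<in> F. C \<subseteq> S}" "{s}"] by (auto simp: finite)
  obtain j where j: "j \<in> I - C" "insert j C \<in> F"
    using F(2) C I S unfolding accessible_def by (metis subset_psubset_trans)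
  have "j \<notin> S" using max[OF j(2)] j(1) C(2) by blast
  have "C \<noteq> {}" using C(1) F(1) by (auto simp: building_set_def)
  then have "{j} \<subset> insert j C" using j(1) by blast
  moreover have "{j} \<in> F" using F(1) by (auto simp: building_set_def)
  ultimately obtain c where "c \<in> insert j C - {j}" "insert c {j} \<in> F"
    using F(2) j(2) unfolding accessible_def by metis
  then show ?thesis using C(2) j(1) \<open>j \<notin> S\<close> by blast
qed

lemma building_set_of_pairs_across_cuts:
  fixes F :: "'a::finite set set"
  assumes F: "building_set F" and "I \<noteq> {}"
    and cut: "\<And>S. S \<noteq> {} \<Longrightarrow> S \<subset> I \<Longrightarrow> \<exists>a\<in>S. \<exists>b\<in>I - S. {a, b} \<in> F"
  shows "I \<in> F"
proof -
  obtain s where "s \<in> I" using assms by blast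
  then have "{s} \<in> {C \<in> F. C \<subseteq> I}" using F(1) by (auto simp: building_set_def)
  then obtain C where C: "C \<in> F" "C \<subseteq> I" and max: "\<And>D. D \<in> F \<Longrightarrow> D \<subseteq> I \<Longrightarrow> C \<subseteq> D \<Longrightarrow> C = D"
    using finite_has_maximal2[of "{C \<in> F. C \<subseteq> I}" "{s}"] by (auto simp: finite)
  have "C = I"
  proof (rule ccontr)
    assume "C \<noteq> I"
    moreover have "C \<noteq> {}" using C(1) F(1) by (auto simp: building_set_def)
    ultimately obtain a b where ab: "a \<in> C" "b \<in> I - C" "{a, b} \<in> F" using cut[of C] C(2) by blast
    then have "C \<union> {a, b} \<in> F" using F C(1) by (auto simp: building_set_def)
    then show False using max[of "C \<union> {a, b}"] ab C(2) by blast
  qed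
  then show ?thesis using C(1) by simp
qed

text \<open>An accessible building set is therefore determined by its two-element members: it consists of
the connected vertex sets of the graph that has these pairs as edges.\<close>

lemma connected_sets_eq_of_pairs:
  fixes F :: "'a::finite set set"
  assumes F: "building_set F" "accessible F" and H: "verts H = UNIV"
    and edges: "edges H = {{a, b} | a b. a \<noteq> b \<and> {a, b} \<in> F}"
  shows "connected_sets H = F"
proof (intro equalityI subsetI)
  fix I assume I: "I \<in> connected_sets H"
  show "I \<in> F"
  proof (rule building_set_of_pairs_across_cuts[OF F(1)])
    show "I \<noteq> {}" using I by (simp add: mem_connected_sets_iff)
    fix S assume S: "S \<noteq> {}" "S \<subset> I"
    obtain e where e: "e \<in> edges H" "e \<subseteq> I" "e \<inter> S \<noteq> {}" "\<not> e \<subseteq> S"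
      using connected_sets_edge_across_cut[OF I S] .
    then obtain a b where "e = {a, b}" "{a, b} \<in> F" unfolding edges by blast
    then have ab: "{a, b} \<in> F" "{b, a} \<in> F" "a \<in> I" "b \<in> I" "a \<in> S \<and> b \<notin> S \<or> b \<in> S \<and> a \<notin> S"
      using e by (auto simp: insert_commute)
    then show "\<exists>a\<in>S. \<exists>b\<in>I - S. {a, b} \<in> F" by blast
  qed
next
  fix I assume I: "I \<in> F"
  have "\<exists>e\<in>edges H. e \<subseteq> I \<and> e \<inter> S \<noteq> {} \<and> \<not> e \<subseteq> S" if S: "S \<noteq> {}" "S \<subset> I" for S
  proof -
    obtain a b where ab: "a \<in> S" "b \<in> I - S" "{a, b} \<in> F"
      using accessible_imp_pair_across_cut[OF F I S] by blast
    then have "{a, b} \<in> edges H" unfolding edges by blast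
    then show ?thesis using ab S by (intro bexI[of _ "{a, b}"]) auto
  qed
  moreover have "I \<noteq> {}" using I F(1) by (auto simp: building_set_def)
  ultimately show "I \<in> connected_sets H" using H by (simp add: mem_connected_sets_iff)
qed

section \<open>Dependent walls\<close>

lemma coord_sum_split:
  "coord_sum T (\<chi> k. if k \<in> C then f k else g k) = sum f (T \<inter> C) + sum g (T - C)"
  unfolding coord_sum_def vec_lambda_beta by (subst sum.If_cases) (auto simp: Diff_eq)

text \<open>Let \<open>J\<close> be minimal among the members properly containing \<open>C\<close>, and suppose that it has at least two
more vertices. Near the common zero set of the coordinates in \<open>J\<close>, only members inside \<open>J\<close> matter,
and by minimality each of them lies in \<open>C\<close>, or avoids \<open>C\<close>, or contains all of \<open>J - C\<close>. In the chamber
with \<open>C\<close> slightly negative and \<open>J - C\<close> positive, all the singletons of \<open>J\<close> and \<open>J\<close> itself are walls,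
although their sums satisfy \<open>coord_sum J y = (\<Sum>k\<in>J. y $ k)\<close>.\<close>

lemma simplicial_imp_accessible:
  fixes F :: "'n::finite set set"
  assumes F: "building_set F" and simplicial: "simplicial_arrangement (hyperplane ` F)"
  shows "accessible F"
  unfolding accessible_def
proof (intro ballI impI, rule ccontr)
  fix C I assume C: "C \<in> F" and "I \<in> F" "C \<subset> I" and no: "\<not> (\<exists>j\<in>I - C. insert j C \<in> F)"
  define A where "A = {J \<in> F. C \<subset> J \<and> J \<subseteq> I}"
  have "I \<in> A" using \<open>I \<in> F\<close> \<open>C \<subset> I\<close> by (simp add: A_def)
  then obtain J where "J \<in> A" and minA: "\<forall>T\<in>A. T \<subseteq> J \<longrightarrow> J = T"
    using finite_has_minimal2[of A I] by auto
  then have J: "J \<in> F" "C \<subset> J" "J \<subseteq> I" by (simp_all add: A_def)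
  have min: "T = J" if "T \<in> F" "C \<subset> T" "T \<subseteq> J" for T
    using minA that J(3) by (auto simp: A_def)
  have ne: "T \<noteq> {}" if "T \<in> F" for T using building_set_nonempty[OF F that] .
  have two: "J - C - {k} \<noteq> {}" if k: "k \<in> J - C" for k
  proof
    assume "J - C - {k} = {}"
    then have "J = insert k C" using k J by blast
    then show False using no k J by blast
  qed
  define N where "N = card C"
  define M where "M = card (J - C)"
  have N: "N \<ge> 1" using ne[OF C] by (simp add: N_def Suc_leI card_gt_0_iff)
  have M: "M \<ge> 1" using J by (auto simp: M_def Suc_leI card_gt_0_iff)
  define p :: "real ^ 'n" where "p = (\<chi> k. if k \<in> J then 0 else 1)"
  have p: "coord_sum T p = 0 \<longleftrightarrow> T \<subseteq> J" for T
    unfolding p_def coord_sum_split by (auto simp: card_eq_0_iff)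
  have trichotomy: "T \<subseteq> C \<or> T \<inter> C = {} \<or> (T \<inter> C \<noteq> {} \<and> T - C = J - C)" if "T \<in> F" "T \<subseteq> J" for T
  proof (rule ccontr)
    assume neg: "\<not> ?thesis"
    then have "T \<union> C \<in> F" using F \<open>T \<in> F\<close> C by (auto simp: building_set_def)
    then have "T \<union> C = J" using min[of "T \<union> C"] neg J(2) \<open>T \<subseteq> J\<close> by blast
    then show False using neg by blast
  qed
  have card_C: "real (card (T \<inter> C)) \<le> real N" for T by (auto simp: N_def intro: card_mono)
  define q :: "real ^ 'n" where "q = (\<chi> k. if k \<in> C then -1 else real N + 1)"
  have q: "coord_sum T q = - real (card (T \<inter> C)) + (real N + 1) * real (card (T - C))" for T
    unfolding q_def coord_sum_split by simp
  have q_neg: "coord_sum T q < 0" if "T \<in> F" "T \<subseteq> C" for T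
  proof -
    have TC: "T - C = {}" "T \<inter> C = T" using that by auto
    show ?thesis using ne[OF that(1)] unfolding q TC by (simp add: card_gt_0_iff)
  qed
  have q_pos: "coord_sum T q > 0" if "\<not> T \<subseteq> C" for T
  proof -
    have "card (T - C) \<ge> 1" using that by (simp add: Suc_leI card_gt_0_iff)
    then have "(real N + 1) * real (card (T - C)) \<ge> (real N + 1) * 1"
      by (intro mult_left_mono) auto
    moreover have "real (card (T \<inter> C)) < (real N + 1) * 1" using card_C[of T] by simp
    ultimately have "real (card (T \<inter> C)) < (real N + 1) * real (card (T - C))"
      by (rule less_le_trans[rotated])
    then show ?thesis unfolding q by simp
  qed
  define W where "W = insert J ((\<lambda>k. {k}) ` J)"
  define c where "c T = (if T = J then 1 else - 1 :: real)" for T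
  have J_card: "J \<noteq> {k}" for k using two J(2) ne[OF C] by blast
  have c_single: "c {k} = -1" for k using J_card[of k] unfolding c_def by metis
  have "c J = 0"
  proof (rule wall_sums_independent[OF simplicial, of p q W c J])
    show "J \<in> W" by (simp add: W_def)
    show "coord_sum T q \<noteq> 0" if "T \<in> F" "coord_sum T p = 0" for T
      using q_neg[OF that(1)] q_pos[of T] by (cases "T \<subseteq> C") auto
    show "(\<Sum>T\<in>W. c T * coord_sum T y) = 0" for y
    proof -
      have "(\<Sum>T\<in>(\<lambda>k. {k}) ` J. c T * coord_sum T y) = - coord_sum J y"
        by (subst sum.reindex) (simp_all add: c_single coord_sum_def sum_negf)
      moreover have "J \<notin> (\<lambda>k. {k}) ` J" using J_card by blast
      ultimately show ?thesis by (simp add: W_def c_def)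
    qed
    fix K assume K: "K \<in> W"
    consider "K = J" | k where "K = {k}" "k \<in> C" | k where "K = {k}" "k \<in> J - C"
      using K by (auto simp: W_def)
    then have "\<exists>y. coord_sum K q * coord_sum K y < 0 \<and>
        (\<forall>T\<in>F. T \<subseteq> J \<longrightarrow> T \<noteq> K \<longrightarrow> 0 < coord_sum T q * coord_sum T y)"
    proof cases
      case 1
      \<comment> \<open>With this weight outside \<open>C\<close>, the sum over \<open>J\<close> is \<open>-1/2\<close>; dropping a vertex of \<open>C\<close> from \<open>J\<close>
          raises the sum by \<open>1\<close> and makes it positive.\<close>
      define r where "r = (real N - 1 / 2) / real M"
      have r: "r > 0" using N M by (simp add: r_def)
      have rM: "r * real M = real N - 1 / 2" using M by (simp add: r_def)
      define y :: "real ^ 'n" where "y = (\<chi> k. if k \<in> C then -1 else r)"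
      have y: "coord_sum T y = - real (card (T \<inter> C)) + r * real (card (T - C))" for T
        unfolding y_def coord_sum_split by simp
      have "coord_sum J y < 0"
        using J(2) rM by (simp add: y inf.absorb2 psubset_imp_subset flip: N_def M_def)
      moreover have "\<not> J \<subseteq> C" using J by blast
      ultimately have "coord_sum J q * coord_sum J y < 0" using q_pos[of J] by (simp add: mult_pos_neg)
      moreover have "0 < coord_sum T q * coord_sum T y" if T: "T \<in> F" "T \<subseteq> J" "T \<noteq> J" for T
        using trichotomy[OF T(1,2)]
      proof (elim disjE conjE)
        assume "T \<subseteq> C"
        then have TC: "T - C = {}" "T \<inter> C = T" by auto
        have "coord_sum T y < 0" using ne[OF T(1)] unfolding y TC by (simp add: card_gt_0_iff)
        then show ?thesis using q_neg[OF T(1) \<open>T \<subseteq> C\<close>] by (simp add: mult_neg_neg)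
      next
        assume 0: "T \<inter> C = {}"
        then have "T - C \<noteq> {}" "\<not> T \<subseteq> C" using ne[OF T(1)] by auto
        then have "coord_sum T y > 0" using 0 r by (simp add: y card_gt_0_iff)
        then show ?thesis using q_pos \<open>\<not> T \<subseteq> C\<close> by simp
      next
        assume mix: "T - C = J - C"
        have "T \<inter> C \<subset> C" using T(2,3) mix J(2) by blast
        then have "card (T \<inter> C) < N" unfolding N_def by (intro psubset_card_mono) auto
        then have "coord_sum T y > 0" using rM by (simp add: y mix flip: M_def)
        moreover have "\<not> T \<subseteq> C" using mix J(2) by blast
        ultimately show ?thesis using q_pos by simp
      qed
      ultimately show ?thesis using 1 by blast
    next
      case (2 k)
      \<comment> \<open>Only the coordinate \<open>k\<close> of \<open>C\<close> becomes positive; any further vertex of \<open>C\<close> outweighs it, and any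
          vertex outside \<open>C\<close> outweighs all of \<open>C\<close>.\<close>
      define f where "f i = (if i = k then 1 else -2 :: real)" for i
      define y :: "real ^ 'n" where "y = (\<chi> i. if i \<in> C then f i else 2 * real N + 1)"
      have y: "coord_sum T y = sum f (T \<inter> C) + (2 * real N + 1) * real (card (T - C))" for T
        unfolding y_def coord_sum_split by simp
      have "coord_sum {k} y > 0" using 2 by (simp add: y_def f_def)
      moreover have "{k} \<in> F" using F by (simp add: building_set_def)
      ultimately have "coord_sum {k} q * coord_sum {k} y < 0"
        using q_neg[of "{k}"] 2 by (simp add: mult_neg_pos)
      moreover have "0 < coord_sum T q * coord_sum T y" if T: "T \<in> F" "T \<subseteq> J" "T \<noteq> {k}" for T
      proof (cases "T \<subseteq> C")
        case True
        then have TC: "T - C = {}" "T \<inter> C = T" by auto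
        have "T - {k} \<noteq> {}" using ne[OF T(1)] T(3) by blast
        then have "card (T - {k}) \<ge> 1" by (simp add: Suc_leI card_gt_0_iff)
        moreover have "sum f (T - {k}) = - 2 * real (card (T - {k}))" by (simp add: f_def)
        moreover have "sum f T \<le> 1 + sum f (T - {k})"
          by (cases "k \<in> T") (auto simp: sum.remove[of T k] f_def)
        ultimately have "coord_sum T y < 0" unfolding y TC by simp
        then show ?thesis using q_neg[OF T(1) True] by (simp add: mult_neg_neg)
      next
        case False
        then have "card (T - C) \<ge> 1" by (simp add: Suc_leI card_gt_0_iff)
        then have "2 * real N + 1 \<le> (2 * real N + 1) * real (card (T - C))" by simp
        moreover have "(\<Sum>i\<in>T \<inter> C. -2) \<le> sum f (T \<inter> C)" by (rule sum_mono) (simp add: f_def)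
        then have "- 2 * real N \<le> sum f (T \<inter> C)" using card_C[of T] by simp
        moreover have "0 < u + w" if "2 * real N + 1 \<le> w" "- 2 * real N \<le> u" for u w :: real
          using that by linarith
        ultimately have "0 < sum f (T \<inter> C) + (2 * real N + 1) * real (card (T - C))" by blast
        then have "coord_sum T y > 0" unfolding y .
        then show ?thesis using q_pos False by simp
      qed
      ultimately show ?thesis using 2 by blast
    next
      case (3 k)
      \<comment> \<open>Here \<open>k\<close> becomes negative. Every member other than \<open>{k}\<close> that leaves \<open>C\<close> contains a second vertex
          of \<open>J - C\<close>, whose weight exceeds what \<open>C\<close> and \<open>k\<close> can subtract.\<close>
      define f where "f i = (if i = k then -1 else real N + 2)" for i
      define y :: "real ^ 'n" where "y = (\<chi> i. if i \<in> C then -1 else f i)"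
      have y: "coord_sum T y = - real (card (T \<inter> C)) + sum f (T - C)" for T
        unfolding y_def coord_sum_split by simp
      have f_big: "sum f S \<ge> real N + 1" if "S - {k} \<noteq> {}" for S
      proof -
        have "card (S - {k}) \<ge> 1" using that by (simp add: Suc_leI card_gt_0_iff)
        then have "(real N + 2) * real (card (S - {k})) \<ge> (real N + 2) * 1"
          by (intro mult_left_mono) auto
        moreover have "sum f (S - {k}) = (real N + 2) * real (card (S - {k}))" by (simp add: f_def)
        ultimately have "sum f (S - {k}) \<ge> real N + 2" by (simp only: mult_1_right)
        moreover have "sum f S \<ge> -1 + sum f (S - {k})"
          by (cases "k \<in> S") (auto simp: sum.remove[of S k] f_def)
        ultimately show ?thesis by linarith
      qed
      have "coord_sum {k} y < 0" using 3 by (simp add: y_def f_def)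
      then have "coord_sum {k} q * coord_sum {k} y < 0"
        using q_pos[of "{k}"] 3 by (simp add: mult_pos_neg)
      moreover have "0 < coord_sum T q * coord_sum T y" if T: "T \<in> F" "T \<subseteq> J" "T \<noteq> {k}" for T
      proof (cases "T \<subseteq> C")
        case True
        then have TC: "T - C = {}" "T \<inter> C = T" by auto
        have "coord_sum T y < 0" using ne[OF T(1)] unfolding y TC by (simp add: card_gt_0_iff)
        then show ?thesis using q_neg[OF T(1) True] by (simp add: mult_neg_neg)
      next
        case False
        have "T - C - {k} \<noteq> {}"
          using trichotomy[OF T(1,2)] False two[OF 3(2)] T(3) ne[OF T(1)] by auto
        then have "coord_sum T y > 0" using f_big[of "T - C"] card_C[of T] by (simp add: y)
        then show ?thesis using q_pos False by simp
      qed
      ultimately show ?thesis using 3 by blast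
    qed
    then show "K \<in> F \<and> coord_sum K p = 0 \<and> (\<exists>y. coord_sum K q * coord_sum K y < 0 \<and>
        (\<forall>T\<in>F. coord_sum T p = 0 \<longrightarrow> T \<noteq> K \<longrightarrow> 0 < coord_sum T q * coord_sum T y))"
      using K J(1) F by (auto simp: p W_def building_set_def)
  qed
  then show False by (simp add: c_def)
qed

lemma coord_sum_blocks:
  assumes "distinct [a, b, d]" "a \<notin> C" "b \<notin> C" "d \<notin> C"
  shows "coord_sum T y = (if a \<in> T then y $ a else 0) + (if b \<in> T then y $ b else 0) +
    (if d \<in> T then y $ d else 0) + coord_sum (T \<inter> C) y + coord_sum (T - insert a (insert b (insert d C))) y"
proof -
  have remove: "coord_sum T y = (if i \<in> T then y $ i else 0) + coord_sum (T - {i}) y" for i T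
    by (cases "i \<in> T") (auto simp: coord_sum_def sum.remove)
  have rest: "T - {a} - {b} - {d} - C = T - insert a (insert b (insert d C))"
    "(T - {a} - {b} - {d}) \<inter> C = T \<inter> C"
    using assms by auto
  have "coord_sum (T - {a} - {b} - {d}) y = coord_sum (T \<inter> C) y + coord_sum (T - insert a (insert b (insert d C))) y"
    using sum.Int_Diff[of "T - {a} - {b} - {d}" "\<lambda>i. y $ i" C] unfolding rest coord_sum_def by simp
  then show ?thesis
    using assms(1) by (auto simp: remove[of T a] remove[of "T - {a}" b] remove[of "T - {a} - {b}" d])
qed

definition claw_free :: "'a set set \<Rightarrow> bool" where
  "claw_free F \<longleftrightarrow>
     (\<nexists>a b d c. distinct [a, b, d, c] \<and> {c, a} \<in> F \<and> {c, b} \<in> F \<and> {c, d} \<in> F)"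

text \<open>In a claw with centre \<open>c\<close> and leaves \<open>a\<close>, \<open>b\<close>, \<open>d\<close> the sums over \<open>abc\<close>, \<open>cd\<close>, \<open>acd\<close> and \<open>bc\<close> satisfy
\<open>abc + cd = acd + bc\<close>. Near a point where only these four and possibly \<open>a\<close> vanish, the signs
\<open>a > 0\<close>, \<open>abc > 0\<close>, \<open>acd > 0\<close>, \<open>bc < 0\<close>, \<open>cd < 0\<close> define a chamber having all four as walls: it is a cone over
a quadrilateral, since \<open>a\<close> equals both \<open>abc - bc\<close> and \<open>acd - cd\<close>. Further edges between the leaves
do no harm.\<close>

lemma simplicial_imp_claw_free:
  fixes F :: "'n::finite set set"
  assumes F: "building_set F" and simplicial: "simplicial_arrangement (hyperplane ` F)"
  shows "claw_free F"
proof (rule ccontr)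
  assume "\<not> claw_free F"
  then obtain a b d c where dist: "distinct [a, b, d, c]"
    and nbrs: "{c, a} \<in> F" "{c, b} \<in> F" "{c, d} \<in> F"
    unfolding claw_free_def by blast
  have "{c, a} \<union> {c, b} \<in> F" "{c, a} \<union> {c, d} \<in> F"
    using building_set_Un[OF F nbrs(1) nbrs(2)] building_set_Un[OF F nbrs(1) nbrs(3)] by simp_all
  then have mem: "{a, b, c} \<in> F" "{a, c, d} \<in> F" "{b, c} \<in> F" "{c, d} \<in> F"
    using nbrs by (simp_all add: insert_commute)
  define v :: "real \<Rightarrow> real \<Rightarrow> real \<Rightarrow> real \<Rightarrow> real ^ 'n" where
    "v \<alpha> \<beta> \<gamma> \<delta> = (\<chi> k. if k = a then \<alpha> else if k = b then \<beta> else if k = c then \<gamma> else if k = d then \<delta> else 10)"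
    for \<alpha> \<beta> \<gamma> \<delta>
  have v: "coord_sum T (v \<alpha> \<beta> \<gamma> \<delta>) = (if a \<in> T then \<alpha> else 0) + (if b \<in> T then \<beta> else 0) +
      (if d \<in> T then \<delta> else 0) + (if c \<in> T then \<gamma> else 0) + 10 * real (card (T - {a, b, d, c}))" for T \<alpha> \<beta> \<gamma> \<delta>
  proof -
    have "coord_sum (T \<inter> {c}) (v \<alpha> \<beta> \<gamma> \<delta>) = (if c \<in> T then \<gamma> else 0)"
      using dist by (cases "c \<in> T") (auto simp: v_def coord_sum_def)
    moreover have "coord_sum (T - {a, b, d, c}) (v \<alpha> \<beta> \<gamma> \<delta>) = 10 * real (card (T - {a, b, d, c}))"
      unfolding coord_sum_def v_def by (simp add: sum.cong)
    ultimately show ?thesis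
      using dist by (subst coord_sum_blocks[of a b d "{c}"]) (auto simp: v_def)
  qed
  \<comment> \<open>The weight \<open>10\<close> on the remaining coordinates keeps every set with further vertices away from
      the hyperplanes through \<open>p\<close>.\<close>
  define p where "p = v 0 1 (-1) 1"
  define q where "q = v 2 0 (-1) 0"
  have zero: "T \<in> {{a}, {b, c}, {c, d}, {a, b, c}, {a, c, d}}"
    if T: "T \<in> F" "coord_sum T p = 0" for T
  proof -
    have "T \<noteq> {}" using T F by (auto simp: building_set_def)
    have "10 * real (card (T - {a, b, d, c})) < 10"
      using T(2) by (simp only: p_def v split: if_splits)
    then have 0: "card (T - {a, b, d, c}) = 0" by linarith
    then have "T \<subseteq> {a, b, d, c}" by (simp add: card_eq_0_iff)
    have pattern: "(b \<in> T \<and> d \<notin> T \<and> c \<in> T) \<or> (b \<notin> T \<and> d \<in> T \<and> c \<in> T) \<or> (b \<notin> T \<and> d \<notin> T \<and> c \<notin> T)"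
      using T(2) 0 by (auto simp: p_def v split: if_splits)
    have eqI: "T = X" if "X \<subseteq> {a, b, d, c}" "\<forall>x\<in>{a, b, d, c}. x \<in> T \<longleftrightarrow> x \<in> X" for X
      using \<open>T \<subseteq> {a, b, d, c}\<close> that by blast
    have "T = {a, b, c}" if "a \<in> T" "b \<in> T" "c \<in> T" "d \<notin> T"
      by (rule eqI) (use dist that in auto)
    moreover have "T = {b, c}" if "a \<notin> T" "b \<in> T" "c \<in> T" "d \<notin> T"
      by (rule eqI) (use dist that in auto)
    moreover have "T = {a, c, d}" if "a \<in> T" "b \<notin> T" "c \<in> T" "d \<in> T"
      by (rule eqI) (use dist that in auto)
    moreover have "T = {c, d}" if "a \<notin> T" "b \<notin> T" "c \<in> T" "d \<in> T"
      by (rule eqI) (use dist that in auto)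
    moreover have "T = {a}" if "a \<in> T" "b \<notin> T" "c \<notin> T" "d \<notin> T"
      by (rule eqI) (use dist that in auto)
    moreover have "T = {}" if "a \<notin> T" "b \<notin> T" "c \<notin> T" "d \<notin> T"
      by (rule eqI) (use dist that in auto)
    ultimately show ?thesis using pattern \<open>T \<noteq> {}\<close> unfolding insert_iff by argo
  qed
  have ne: "{a, b, c} \<noteq> {a, c, d}" "{a, b, c} \<noteq> {b, c}" "{a, b, c} \<noteq> {c, d}"
    "{a, c, d} \<noteq> {b, c}" "{a, c, d} \<noteq> {c, d}" "{b, c} \<noteq> {c, d}"
    using dist by (auto simp: set_eq_iff)
  define W where "W = {{a, b, c}, {c, d}, {a, c, d}, {b, c}}"
  define k where "k T = (if T = {a, b, c} \<or> T = {c, d} then 1 else -1 :: real)" for T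
  have val: "v \<alpha> \<beta> \<gamma> \<delta> $ a = \<alpha>" "coord_sum {b, c} (v \<alpha> \<beta> \<gamma> \<delta>) = \<beta> + \<gamma>"
    "coord_sum {c, d} (v \<alpha> \<beta> \<gamma> \<delta>) = \<gamma> + \<delta>" "coord_sum {a, b, c} (v \<alpha> \<beta> \<gamma> \<delta>) = \<alpha> + \<beta> + \<gamma>"
    "coord_sum {a, c, d} (v \<alpha> \<beta> \<gamma> \<delta>) = \<alpha> + \<gamma> + \<delta>" for \<alpha> \<beta> \<gamma> \<delta>
    using dist by (auto simp: v_def coord_sum_def)
  have "k {a, b, c} = 0"
  proof (rule wall_sums_independent[OF simplicial, of p q W k])
    show "coord_sum T q \<noteq> 0" if "T \<in> F" "coord_sum T p = 0" for T
      using zero[OF that] by (auto simp: q_def val)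
    show "(\<Sum>T\<in>W. k T * coord_sum T y) = 0" for y
      using ne dist by (simp add: W_def k_def coord_sum_def)
    show "{a, b, c} \<in> W" by (simp add: W_def)
    have wall: "\<exists>y. coord_sum T q * coord_sum T y < 0 \<and>
        (\<forall>I\<in>F. coord_sum I p = 0 \<longrightarrow> I \<noteq> T \<longrightarrow> 0 < coord_sum I q * coord_sum I y)"
      if neg: "coord_sum T q * coord_sum T (v 2 \<beta> (-1) \<delta>) < 0"
        and pos: "\<And>I. I \<in> {{a}, {b, c}, {c, d}, {a, b, c}, {a, c, d}} \<Longrightarrow> I \<noteq> T \<Longrightarrow>
          0 < coord_sum I q * coord_sum I (v 2 \<beta> (-1) \<delta>)" for T \<beta> \<delta>
    proof (intro exI conjI ballI impI)
      show "coord_sum T q * coord_sum T (v 2 \<beta> (-1) \<delta>) < 0" by (rule neg)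
      show "0 < coord_sum I q * coord_sum I (v 2 \<beta> (-1) \<delta>)"
        if "I \<in> F" "coord_sum I p = 0" "I \<noteq> T" for I
        using zero[OF that(1,2)] that(3) by (rule pos)
    qed
    fix T assume "T \<in> W"
    then consider "T = {a, b, c}" | "T = {b, c}" | "T = {a, c, d}" | "T = {c, d}"
      by (auto simp: W_def)
    then have "\<exists>y. coord_sum T q * coord_sum T y < 0 \<and>
        (\<forall>I\<in>F. coord_sum I p = 0 \<longrightarrow> I \<noteq> T \<longrightarrow> 0 < coord_sum I q * coord_sum I y)"
    proof cases
      case 1 then show ?thesis by (intro wall[of _ "-2" 0]) (auto simp: q_def val)
    next
      case 2 then show ?thesis by (intro wall[of _ 2 0]) (auto simp: q_def val)
    next
      case 3 then show ?thesis by (intro wall[of _ 0 "-2"]) (auto simp: q_def val)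
    next
      case 4 then show ?thesis by (intro wall[of _ 0 2]) (auto simp: q_def val)
    qed
    then show "T \<in> F \<and> coord_sum T p = 0 \<and> (\<exists>y. coord_sum T q * coord_sum T y < 0 \<and>
        (\<forall>I\<in>F. coord_sum I p = 0 \<longrightarrow> I \<noteq> T \<longrightarrow> 0 < coord_sum I q * coord_sum I y))"
      using \<open>T \<in> W\<close> mem by (auto simp: W_def p_def val)
  qed
  then show False by (simp add: k_def)
qed

text \<open>For four blocks \<open>a\<close>, \<open>b\<close>, \<open>C\<close>, \<open>d\<close> in cyclic order with all unions of neighbouring blocks in \<open>F\<close>, the
relation is \<open>ab + Cd = bC + da\<close>. Near a point where the blocks have the sums \<open>1\<close>, \<open>-1\<close>, \<open>1\<close>, \<open>-1\<close>, and where no proper nonempty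
part of \<open>C\<close> has an integral sum, only these four unions and the union of all blocks can vanish. The
chamber on which they are positive again has the four unions as walls. Only one of the blocks
needs to be larger than a vertex to cover cycles of all lengths.\<close>

lemma simplicial_imp_no_four_cycle:
  fixes F :: "'n::finite set set"
  assumes F: "building_set F" and simplicial: "simplicial_arrangement (hyperplane ` F)"
    and dist: "distinct [a, b, d]" "a \<notin> C" "b \<notin> C" "d \<notin> C" "C \<noteq> {}"
    and mem: "{a, b} \<in> F" "insert b C \<in> F" "insert d C \<in> F" "{d, a} \<in> F"
  shows False
proof -
  obtain c where c: "c \<in> C" using dist by blast
  define v :: "real \<Rightarrow> real \<Rightarrow> (_ \<Rightarrow> real) \<Rightarrow> real \<Rightarrow> real ^ 'n" where
    "v \<alpha> \<beta> \<gamma> \<delta> = (\<chi> k. if k = a then \<alpha> else if k = b then \<beta> else if k = d then \<delta> else if k \<in> C then \<gamma> k else 10)"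
    for \<alpha> \<beta> \<gamma> \<delta>
  let ?R = "\<lambda>T. T - insert a (insert b (insert d C))"
  have v: "coord_sum T (v \<alpha> \<beta> \<gamma> \<delta>) = (if a \<in> T then \<alpha> else 0) + (if b \<in> T then \<beta> else 0) +
      (if d \<in> T then \<delta> else 0) + sum \<gamma> (T \<inter> C) + 10 * real (card (?R T))" for T \<alpha> \<beta> \<gamma> \<delta>
  proof -
    have "coord_sum (T \<inter> C) (v \<alpha> \<beta> \<gamma> \<delta>) = sum \<gamma> (T \<inter> C)"
      unfolding coord_sum_def v_def using dist by (intro sum.cong) auto
    moreover have "coord_sum (?R T) (v \<alpha> \<beta> \<gamma> \<delta>) = 10 * real (card (?R T))"
      unfolding coord_sum_def v_def by (simp add: sum.cong)
    ultimately show ?thesis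
      using dist by (subst coord_sum_blocks[of a b d C]) (auto simp: v_def)
  qed
  define N where "N = card C"
  have N: "N > 0" using dist by (simp add: N_def card_gt_0_iff)
  \<comment> \<open>Spreading the sum \<open>1\<close> evenly over \<open>C\<close> gives the proper nonempty parts sums strictly between
      \<open>0\<close> and \<open>1\<close>, which the other coordinates, all integral, cannot cancel.\<close>
  define p where "p = v 1 (-1) (\<lambda>_. 1 / real N) (-1)"
  define q where "q = v 1 1 (\<lambda>k. if k = c then 1 else 0) 1"
  let ?Z = "{{a, b}, insert b C, insert d C, {d, a}, insert a (insert b (insert d C))}"
  have zero: "T \<in> ?Z" if T: "T \<in> F" "coord_sum T p = 0" for T
  proof -
    have "T \<noteq> {}" using T F by (auto simp: building_set_def)
    define t where "t = real (card (T \<inter> C)) / real N"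
    have t: "0 \<le> t" "t \<le> 1"
      using N card_mono[of C "T \<inter> C"] by (auto simp: t_def N_def)
    have sum: "(if a \<in> T then 1 else 0) + (if b \<in> T then -1 else 0) +
      (if d \<in> T then -1 else 0) + t + 10 * real (card (?R T)) = 0"
      using T(2) by (simp add: p_def v t_def)
    have "10 * real (card (?R T)) < 10"
      using sum t by (simp only: split: if_splits)
    then have 0: "card (?R T) = 0" by linarith
    then have "T \<subseteq> insert a (insert b (insert d C))" by (simp add: card_eq_0_iff)
    have t01: "t = 0 \<or> t = 1" using sum t 0 by (auto split: if_splits)
    have t0: "T \<inter> C = {}" if "t = 0" using that N by (simp add: t_def card_eq_0_iff)
    have t1: "T \<inter> C = C" if "t = 1"
    proof -
      have "card (T \<inter> C) = card C" using that N by (simp add: t_def N_def)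
      then show ?thesis by (intro card_subset_eq) auto
    qed
    have pattern: "(t = 0 \<and> a \<in> T \<and> (b \<in> T \<longleftrightarrow> d \<notin> T)) \<or> (t = 0 \<and> a \<notin> T \<and> b \<notin> T \<and> d \<notin> T) \<or>
       (t = 1 \<and> a \<in> T \<and> b \<in> T \<and> d \<in> T) \<or> (t = 1 \<and> a \<notin> T \<and> (b \<in> T \<longleftrightarrow> d \<notin> T))"
      using t01 sum 0 by (auto split: if_splits)
    have eqI: "T = X" if "X \<subseteq> insert a (insert b (insert d C))" "T \<inter> C = X \<inter> C"
      "\<forall>x\<in>{a, b, d}. x \<in> T \<longleftrightarrow> x \<in> X" for X
      using \<open>T \<subseteq> insert a (insert b (insert d C))\<close> that by blast
    have "T = {a, b}" if "T \<inter> C = {}" "a \<in> T" "b \<in> T" "d \<notin> T"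
      by (rule eqI) (use dist that in auto)
    moreover have "T = {d, a}" if "T \<inter> C = {}" "a \<in> T" "b \<notin> T" "d \<in> T"
      by (rule eqI) (use dist that in auto)
    moreover have "T = {}" if "T \<inter> C = {}" "a \<notin> T" "b \<notin> T" "d \<notin> T"
      by (rule eqI) (use dist that in auto)
    moreover have "T = insert b C" if "T \<inter> C = C" "a \<notin> T" "b \<in> T" "d \<notin> T"
      by (rule eqI) (use dist that in auto)
    moreover have "T = insert d C" if "T \<inter> C = C" "a \<notin> T" "b \<notin> T" "d \<in> T"
      by (rule eqI) (use dist that in auto)
    moreover have "T = insert a (insert b (insert d C))" if "T \<inter> C = C" "a \<in> T" "b \<in> T" "d \<in> T"
      by (rule eqI) (use dist that in auto)
    ultimately show ?thesis
      using pattern \<open>T \<noteq> {}\<close> t0 t1 unfolding insert_iff by argo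
  qed
  have ne: "{a, b} \<noteq> insert b C" "{a, b} \<noteq> insert d C" "{a, b} \<noteq> {d, a}"
    "insert b C \<noteq> insert d C" "insert b C \<noteq> {d, a}" "insert d C \<noteq> {d, a}"
    "insert a (insert b (insert d C)) \<noteq> {a, b}" "insert a (insert b (insert d C)) \<noteq> insert b C"
    "insert a (insert b (insert d C)) \<noteq> insert d C" "insert a (insert b (insert d C)) \<noteq> {d, a}"
    using dist c by auto
  define W where "W = {{a, b}, insert d C, insert b C, {d, a}}"
  define k where "k T = (if T = {a, b} \<or> T = insert d C then 1 else -1 :: real)" for T
  have val: "coord_sum {a, b} (v \<alpha> \<beta> \<gamma> \<delta>) = \<alpha> + \<beta>" "coord_sum (insert b C) (v \<alpha> \<beta> \<gamma> \<delta>) = \<beta> + sum \<gamma> C"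
    "coord_sum (insert d C) (v \<alpha> \<beta> \<gamma> \<delta>) = sum \<gamma> C + \<delta>" "coord_sum {d, a} (v \<alpha> \<beta> \<gamma> \<delta>) = \<alpha> + \<delta>"
    "coord_sum (insert a (insert b (insert d C))) (v \<alpha> \<beta> \<gamma> \<delta>) = \<alpha> + \<beta> + sum \<gamma> C + \<delta>" for \<alpha> \<beta> \<gamma> \<delta>
    using dist unfolding v by (auto simp: insert_absorb Int_absorb1 Int_insert_left insert_Diff_if)
  have q: "coord_sum T q > 0" if "T \<in> ?Z" for T
    using that c by (auto simp: q_def val sum.delta)
  have "k {a, b} = 0"
  proof (rule wall_sums_independent[OF simplicial, of p q W k])
    show "coord_sum T q \<noteq> 0" if "T \<in> F" "coord_sum T p = 0" for T
      using q[OF zero[OF that]] by simp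
    show "(\<Sum>T\<in>W. k T * coord_sum T y) = 0" for y
    proof -
      have "a \<noteq> b" "d \<noteq> a" using dist by auto
      then have "coord_sum {a, b} y = y $ a + y $ b" "coord_sum {d, a} y = y $ d + y $ a"
        "coord_sum (insert b C) y = y $ b + coord_sum C y" "coord_sum (insert d C) y = y $ d + coord_sum C y"
        using dist by (simp_all add: coord_sum_def)
      moreover have "k {a, b} = 1" "k (insert d C) = 1" "k (insert b C) = -1" "k {d, a} = -1"
        unfolding k_def using ne by metis+
      moreover have "(\<Sum>T\<in>W. k T * coord_sum T y) = k {a, b} * coord_sum {a, b} y +
          (k (insert d C) * coord_sum (insert d C) y + (k (insert b C) * coord_sum (insert b C) y +
          k {d, a} * coord_sum {d, a} y))"
        unfolding W_def by (simp only: sum.insert finite.intros insert_iff empty_iff ne ne[symmetric] simp_thms sum.empty add_0_right)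
      ultimately show ?thesis by simp
    qed
    show "{a, b} \<in> W" by (simp add: W_def)
    have wall: "\<exists>y. coord_sum T q * coord_sum T y < 0 \<and>
        (\<forall>I\<in>F. coord_sum I p = 0 \<longrightarrow> I \<noteq> T \<longrightarrow> 0 < coord_sum I q * coord_sum I y)"
      if "T \<in> ?Z" "coord_sum T (v \<alpha> \<beta> (\<lambda>k. if k = c then \<gamma> else 0) \<delta>) < 0"
        and "\<And>I. I \<in> ?Z \<Longrightarrow> I \<noteq> T \<Longrightarrow> 0 < coord_sum I (v \<alpha> \<beta> (\<lambda>k. if k = c then \<gamma> else 0) \<delta>)" for T \<alpha> \<beta> \<gamma> \<delta>
    proof (intro exI conjI ballI impI)
      show "coord_sum T q * coord_sum T (v \<alpha> \<beta> (\<lambda>k. if k = c then \<gamma> else 0) \<delta>) < 0"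
        using q[OF that(1)] that(2) by (rule mult_pos_neg)
      fix I assume "I \<in> F" "coord_sum I p = 0" "I \<noteq> T"
      then show "0 < coord_sum I q * coord_sum I (v \<alpha> \<beta> (\<lambda>k. if k = c then \<gamma> else 0) \<delta>)"
        using q[OF zero] that(3)[OF zero] by (intro mult_pos_pos)
    qed
    \<comment> \<open>Up to rotation the same vector works for all four walls: block sums \<open>0\<close>, \<open>-1\<close>, \<open>2\<close>, \<open>1\<close> make
        exactly the first union negative.\<close>
    fix T assume "T \<in> W"
    then consider "T = {a, b}" | "T = insert b C" | "T = insert d C" | "T = {d, a}"
      by (auto simp: W_def)
    then have "\<exists>y. coord_sum T q * coord_sum T y < 0 \<and>
        (\<forall>I\<in>F. coord_sum I p = 0 \<longrightarrow> I \<noteq> T \<longrightarrow> 0 < coord_sum I q * coord_sum I y)"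
    proof cases
      case 1 then show ?thesis using c by (intro wall[of _ 0 "-1" 2 1]) (auto simp: val)
    next
      case 2 then show ?thesis using c by (intro wall[of _ 1 0 "-1" 2]) (auto simp: val)
    next
      case 3 then show ?thesis using c by (intro wall[of _ 2 1 0 "-1"]) (auto simp: val)
    next
      case 4 then show ?thesis using c by (intro wall[of _ "-1" 2 1 0]) (auto simp: val)
    qed
    then show "T \<in> F \<and> coord_sum T p = 0 \<and> (\<exists>y. coord_sum T q * coord_sum T y < 0 \<and>
        (\<forall>I\<in>F. coord_sum I p = 0 \<longrightarrow> I \<noteq> T \<longrightarrow> 0 < coord_sum I q * coord_sum I y))"
      using \<open>T \<in> W\<close> mem N by (auto simp: W_def p_def val N_def)
  qed
  then show False by (simp add: k_def)
qed

section \<open>From a simplicial arrangement to a path or a triangle\<close>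

lemma claw_freeD:
  "claw_free F \<Longrightarrow> distinct [a, b, d, c] \<Longrightarrow> {c, a} \<in> F \<Longrightarrow> {c, b} \<in> F \<Longrightarrow> {c, d} \<in> F \<Longrightarrow> False"
  unfolding claw_free_def by blast

lemma successively_pairs_imp_mem:
  assumes F: "building_set F" and "successively (\<lambda>u v. {u, v} \<in> F) vs" "vs \<noteq> []"
  shows "set vs \<in> F"
  using assms(2,3)
proof (induction vs)
  case (Cons v vs)
  show ?case
  proof (cases "vs = []")
    case True
    then show ?thesis using building_set_singleton[OF F] by simp
  next
    case False
    then have "{v, hd vs} \<in> F" "set vs \<in> F" using Cons by (auto simp: successively_Cons)
    moreover have "hd vs \<in> {v, hd vs} \<inter> set vs" using False by simp
    ultimately have "{v, hd vs} \<union> set vs \<in> F" by (intro building_set_Un[OF F]) blast+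
    moreover have "{v, hd vs} \<union> set vs = set (v # vs)" using False by auto
    ultimately show ?thesis by simp
  qed
qed simp

text \<open>A longest path is Hamiltonian. Otherwise some pair joins a vertex of the path to a vertex
outside; at an end of the path this would lengthen it, and at an interior vertex it would
complete a claw.\<close>

lemma obtain_hamiltonian_path:
  fixes F :: "'a::finite set set"
  assumes F: "building_set F" "accessible F" and univ: "UNIV \<in> F"
    and claw: "claw_free F"
  obtains vs where "distinct vs" "set vs = UNIV" "successively (\<lambda>u v. {u, v} \<in> F) vs"
proof -
  define P where "P vs \<longleftrightarrow> distinct vs \<and> vs \<noteq> [] \<and> successively (\<lambda>u v. {u, v} \<in> F) vs" for vs :: "'a list"
  have "length vs < Suc CARD('a)" if "P vs" for vs
    using that card_mono[of UNIV "set vs"] by (simp add: P_def distinct_card less_Suc_eq_le)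
  moreover have "P [undefined]" by (simp add: P_def)
  ultimately obtain vs where vs: "P vs" and max: "\<And>ws. P ws \<Longrightarrow> length ws \<le> length vs"
    using ex_has_greatest_nat[of P "[undefined]" length] by blast
  have "set vs = UNIV"
  proof (rule ccontr)
    assume "set vs \<noteq> UNIV"
    moreover have "set vs \<noteq> {}" using vs by (simp add: P_def)
    ultimately obtain c j where cj: "c \<in> set vs" "j \<notin> set vs" "{c, j} \<in> F"
      using accessible_imp_pair_across_cut[OF F univ, of "set vs"] by auto
    then have jc: "{j, c} \<in> F" by (simp add: insert_commute)
    obtain us ws where split: "vs = us @ c # ws" using cj(1) by (meson split_list)
    have "us \<noteq> []"
    proof
      assume "us = []"
      then have "P (j # vs)" using vs cj jc split by (simp add: P_def successively_Cons)
      then show False using max[of "j # vs"] by simp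
    qed
    moreover have "ws \<noteq> []"
    proof
      assume "ws = []"
      then have "P (vs @ [j])" using vs cj split by (auto simp: P_def successively_append_iff)
      then show False using max[of "vs @ [j]"] by simp
    qed
    ultimately have "{last us, c} \<in> F" "{c, hd ws} \<in> F"
      using vs split by (auto simp: P_def successively_append_iff successively_Cons)
    then have "{c, last us} \<in> F" "{c, hd ws} \<in> F" by (simp_all add: insert_commute)
    moreover have "last us \<in> set us" "hd ws \<in> set ws" using \<open>us \<noteq> []\<close> \<open>ws \<noteq> []\<close> by auto
    then have "distinct [last us, hd ws, j, c]" using vs cj(2) split by (auto simp: P_def)
    ultimately show False using claw_freeD[OF claw] cj(3) by blast
  qed
  moreover have "distinct vs" "successively (\<lambda>u v. {u, v} \<in> F) vs" using vs unfolding P_def by blast+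
  ultimately show ?thesis by (intro that)
qed

text \<open>Interior vertices of the path already have two neighbours, so any further pair must join the two
ends of the path.\<close>

lemma pair_in_hamiltonian_path:
  fixes F :: "'a::finite set set"
  assumes vs: "distinct vs" "successively (\<lambda>u v. {u, v} \<in> F) vs"
    and claw: "claw_free F"
    and ij: "i < j" "j < length vs" "{vs ! i, vs ! j} \<in> F"
  shows "j = Suc i \<or> (i = 0 \<and> j = length vs - 1)"
proof (rule ccontr)
  assume neg: "\<not> ?thesis"
  have step: "{vs ! k, vs ! Suc k} \<in> F" "{vs ! Suc k, vs ! k} \<in> F" if "Suc k < length vs" for k
    using vs(2) that unfolding successively_conv_nth by (auto simp: insert_commute)
  have ji: "{vs ! j, vs ! i} \<in> F" using ij(3) by (simp add: insert_commute)
  show False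
  proof (cases "i = 0")
    case False
    then obtain h where h: "i = Suc h" by (cases i) auto
    have "distinct [vs ! h, vs ! Suc i, vs ! j, vs ! i]"
      using neg ij h vs(1) by (auto simp: nth_eq_iff_index_eq)
    then show False using claw_freeD[OF claw, of "vs ! h" "vs ! Suc i" "vs ! j" "vs ! i"] step[of h] step[of i] ij h by simp
  next
    case True
    then have j: "Suc j < length vs" "j \<noteq> Suc i" using neg ij by auto
    then obtain h where h: "j = Suc h" "h \<noteq> i" using ij by (cases j) auto
    have "distinct [vs ! h, vs ! Suc j, vs ! i, vs ! j]"
      using j ij h vs(1) by (auto simp: nth_eq_iff_index_eq)
    then show False using claw_freeD[OF claw, of "vs ! h" "vs ! Suc j" "vs ! i" "vs ! j"] step[of h] step[of j] ji j h by simp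
  qed
qed

lemma no_long_hamiltonian_cycle:
  fixes F :: "'n::finite set set"
  assumes F: "building_set F" "simplicial_arrangement (hyperplane ` F)"
    and vs: "distinct vs" "successively (\<lambda>u v. {u, v} \<in> F) vs" "length vs \<ge> 4"
    and close: "{hd vs, last vs} \<in> F"
  shows False
proof -
  obtain a b ms d where eq: "vs = a # b # ms @ [d]" and "ms \<noteq> []"
  proof -
    obtain a b us where 1: "vs = a # b # us" "length us \<ge> 2"
      using vs(3) by (cases vs; cases "tl vs") auto
    then have "us = butlast us @ [last us]" by (metis append_butlast_last_id le_zero_eq list.size(3) zero_neq_numeral)
    moreover have "butlast us \<noteq> []" using 1(2) by (cases us; cases "tl us") auto
    ultimately show ?thesis using that 1(1) by metis
  qed
  have "set (b # ms) \<in> F" "set (ms @ [d]) \<in> F"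
    using vs(2) \<open>ms \<noteq> []\<close> unfolding eq
    by (intro successively_pairs_imp_mem[OF F(1)]; auto simp: successively_Cons successively_append_iff)+
  moreover have "{a, b} \<in> F" "{d, a} \<in> F"
    using vs(2) close eq by (simp_all add: insert_commute)
  ultimately show False
    using vs(1) \<open>ms \<noteq> []\<close> by (intro simplicial_imp_no_four_cycle[OF F, of a b d "set ms"]) (auto simp: eq)
qed

lemma C3_relabel_edges:
  "edges (relabel \<sigma> C3) = {{\<sigma> 1, \<sigma> 2}, {\<sigma> 2, \<sigma> 3}, {\<sigma> 1, \<sigma> 3}}"
  by (simp add: relabel_def C3_def)

lemma path_graph_relabel_edges:
  "edges (relabel \<sigma> (path_graph n)) = {{\<sigma> i, \<sigma> (Suc i)} | i. 1 \<le> i \<and> i < n}"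
proof -
  have "edges (relabel \<sigma> (path_graph n)) = (\<lambda>e. \<sigma> ` e) ` (\<lambda>i. {i, Suc i}) ` {i. 1 \<le> i \<and> i < n}"
    by (auto simp: relabel_def path_graph_def)
  then show ?thesis by (auto simp: image_image)
qed

lemma verts_relabel_path_graph:
  "bij_betw \<sigma> {1..n} (UNIV :: 'a set) \<Longrightarrow> verts (relabel \<sigma> (path_graph n)) = UNIV"
  by (simp add: relabel_def path_graph_def bij_betw_imp_surj_on)

lemma verts_relabel_C3:
  "bij_betw \<sigma> {1..3} (UNIV :: 'a set) \<Longrightarrow> verts (relabel \<sigma> C3) = UNIV"
proof -
  have "{1, 2, 3} = {1..3::nat}" by auto
  then show "bij_betw \<sigma> {1..3} (UNIV :: 'a set) \<Longrightarrow> verts (relabel \<sigma> C3) = UNIV"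
    by (simp add: relabel_def C3_def bij_betw_imp_surj_on)
qed

text \<open>The only freedom left is a pair joining the two ends of the Hamiltonian path: without it the graph
is a path, and with it a cycle, which must be a triangle.\<close>

lemma simplicial_imp_path_or_C3:
  fixes F :: "'n::finite set set"
  assumes F: "building_set F" and univ: "UNIV \<in> F"
    and simplicial: "simplicial_arrangement (hyperplane ` F)"
  obtains \<sigma> where "bij_betw \<sigma> {1..CARD('n)} (UNIV :: 'n set)"
    and "F = connected_sets (relabel \<sigma> (path_graph CARD('n))) \<or>
      (CARD('n) = 3 \<and> F = connected_sets (relabel \<sigma> C3))"
proof -
  have acc: "accessible F" by (rule simplicial_imp_accessible[OF F simplicial])
  have claw: "claw_free F" by (rule simplicial_imp_claw_free[OF F simplicial])
  obtain vs where vs: "distinct vs" "set vs = UNIV" "successively (\<lambda>u v. {u, v} \<in> F) vs"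
    using obtain_hamiltonian_path[OF F acc univ claw] .
  have len: "length vs = CARD('n)" using vs distinct_card by metis
  define \<sigma> where "\<sigma> i = vs ! (i - 1)" for i
  have bij: "bij_betw \<sigma> {1..CARD('n)} UNIV"
  proof (rule bij_betw_imageI)
    show "inj_on \<sigma> {1..CARD('n)}"
      using vs(1) by (auto simp: inj_on_def \<sigma>_def nth_eq_iff_index_eq len)
    have "v \<in> \<sigma> ` {1..CARD('n)}" for v
    proof -
      have "v \<in> set vs" using vs(2) by simp
      then obtain k where "k < length vs" "vs ! k = v" by (auto simp: in_set_conv_nth)
      then have "v = \<sigma> (Suc k)" "Suc k \<in> {1..CARD('n)}" by (auto simp: \<sigma>_def len)
      then show ?thesis by blast
    qed
    then show "\<sigma> ` {1..CARD('n)} = UNIV" by (rule UNIV_eq_I[symmetric])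
  qed
  have step: "{vs ! k, vs ! Suc k} \<in> F" if "Suc k < length vs" for k
    using vs(3) that unfolding successively_conv_nth by blast
  have path: "{{\<sigma> i, \<sigma> (Suc i)} | i. 1 \<le> i \<and> i < CARD('n)} = {{vs ! k, vs ! Suc k} | k. Suc k < length vs}" (is "?E = ?P")
  proof (intro equalityI subsetI)
    fix e assume "e \<in> ?E"
    then obtain i where "e = {\<sigma> i, \<sigma> (Suc i)}" "1 \<le> i" "i < CARD('n)" by blast
    then show "e \<in> ?P" using len by (auto simp: \<sigma>_def intro!: exI[of _ "i - 1"])
  next
    fix e assume "e \<in> ?P"
    then obtain k where "e = {vs ! k, vs ! Suc k}" "Suc k < length vs" by blast
    then show "e \<in> ?E" using len by (auto simp: \<sigma>_def intro!: exI[of _ "Suc k"])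
  qed
  have ordered: "\<exists>i j. i < j \<and> j < length vs \<and> {a, b} = {vs ! i, vs ! j}" if "a \<noteq> b" for a b
  proof -
    obtain i j where ij: "i < length vs" "j < length vs" "a = vs ! i" "b = vs ! j"
      using vs(2) by (metis UNIV_I in_set_conv_nth)
    then consider "i < j" | "j < i" using \<open>a \<noteq> b\<close> by (metis linorder_neqE_nat)
    then show ?thesis using ij by cases (blast, metis insert_commute)
  qed
  define chord where "chord \<longleftrightarrow> length vs \<ge> 3 \<and> {hd vs, last vs} \<in> F"
  have ne: "vs \<noteq> []" using vs(2) by auto
  show ?thesis
  proof (cases chord)
    case True
    then have "length vs = 3"
      using no_long_hamiltonian_cycle[OF F simplicial vs(1,3)] by (fastforce simp: chord_def)
    then obtain a b c where abc: "vs = [a, b, c]"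
      by (metis length_0_conv length_Suc_conv numeral_3_eq_3)
    have \<sigma>: "\<sigma> 1 = a" "\<sigma> 2 = b" "\<sigma> 3 = c" by (simp_all add: \<sigma>_def abc)
    have pairs: "{a, b} \<in> F" "{b, c} \<in> F" "{a, c} \<in> F" using vs(3) True by (simp_all add: abc chord_def)
    have "connected_sets (relabel \<sigma> C3) = F"
    proof (rule connected_sets_eq_of_pairs[OF F acc])
      show "verts (relabel \<sigma> C3) = UNIV"
        using bij \<open>length vs = 3\<close> by (intro verts_relabel_C3) (simp flip: len)
      have "{x, y} \<in> {{a, b}, {b, c}, {a, c}}" if "x \<noteq> y" for x y
      proof -
        have "x \<in> {a, b, c}" "y \<in> {a, b, c}" using vs(2) abc by auto
        then show ?thesis using that by (elim insertE emptyE) (simp_all add: insert_commute)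
      qed
      then have "{{x, y} |x y. x \<noteq> y \<and> {x, y} \<in> F} \<subseteq> {{a, b}, {b, c}, {a, c}}" by blast
      moreover have "{{a, b}, {b, c}, {a, c}} \<subseteq> {{x, y} |x y. x \<noteq> y \<and> {x, y} \<in> F}"
        using pairs vs(1) abc by auto
      ultimately show "edges (relabel \<sigma> C3) = {{x, y} |x y. x \<noteq> y \<and> {x, y} \<in> F}"
        unfolding C3_relabel_edges \<sigma> by blast
    qed
    then show ?thesis using that[OF bij] len abc by simp
  next
    case False
    have "connected_sets (relabel \<sigma> (path_graph CARD('n))) = F"
    proof (rule connected_sets_eq_of_pairs[OF F acc])
      show "verts (relabel \<sigma> (path_graph CARD('n))) = UNIV" by (rule verts_relabel_path_graph[OF bij])
      have "{vs ! k, vs ! Suc k} \<in> {{x, y} |x y. x \<noteq> y \<and> {x, y} \<in> F}" if "Suc k < length vs" for k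
      proof -
        have "vs ! k \<noteq> vs ! Suc k" using that vs(1) by (simp add: nth_eq_iff_index_eq)
        then show ?thesis using step[OF that] by blast
      qed
      moreover have "\<exists>k. Suc k < length vs \<and> {x, y} = {vs ! k, vs ! Suc k}" if xy: "x \<noteq> y" "{x, y} \<in> F" for x y
      proof -
        obtain i j where ij: "i < j" "j < length vs" "{x, y} = {vs ! i, vs ! j}" using ordered[OF xy(1)] by blast
        then have "j = Suc i \<or> (i = 0 \<and> j = length vs - 1)"
          using pair_in_hamiltonian_path[OF vs(1,3) claw ij(1,2)] xy(2) by metis
        moreover have "j = Suc i" if "i = 0" "j = length vs - 1"
        proof (rule ccontr)
          assume "j \<noteq> Suc i"
          then have "chord" using that ij xy(2) ne by (simp add: chord_def hd_conv_nth last_conv_nth)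
          then show False using False by simp
        qed
        ultimately show ?thesis using ij by auto
      qed
      ultimately show "edges (relabel \<sigma> (path_graph CARD('n))) = {{x, y} |x y. x \<noteq> y \<and> {x, y} \<in> F}"
        unfolding path_graph_relabel_edges path by blast
    qed
    then show ?thesis using that[OF bij] by simp
  qed
qed

section \<open>Paths and the triangle are simplicial\<close>

lemma edge_in_connected_sets:
  assumes "e \<in> edges G" "e \<noteq> {}" "e \<subseteq> verts G"
  shows "e \<in> connected_sets G"
  unfolding mem_connected_sets_iff
proof (intro conjI allI impI)
  fix S assume "S \<noteq> {} \<and> S \<subset> e"
  then have "e \<inter> S \<noteq> {}" "\<not> e \<subseteq> S" by auto
  then show "\<exists>e'\<in>edges G. e' \<subseteq> e \<and> e' \<inter> S \<noteq> {} \<and> \<not> e' \<subseteq> S" using assms(1) by blast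
qed (use assms in auto)

lemma connected_sets_path_graph:
  fixes \<sigma> :: "nat \<Rightarrow> 'a"
  assumes \<sigma>: "bij_betw \<sigma> {1..n} UNIV"
  shows "connected_sets (relabel \<sigma> (path_graph n)) = {\<sigma> ` {a<..b} | a b. a < b \<and> b \<le> n}"
proof -
  let ?G = "relabel \<sigma> (path_graph n)"
  have verts: "verts ?G = UNIV" by (rule verts_relabel_path_graph[OF \<sigma>])
  note bs = building_set_connected_sets[OF verts]
  have inj: "inj_on \<sigma> {1..n}" and surj: "\<sigma> ` {1..n} = UNIV" using \<sigma> by (auto simp: bij_betw_def)
  have "\<sigma> ` {a<..b} \<in> connected_sets ?G" if "a < b" "b \<le> n" for a b
    using that
  proof (induction b)
    case (Suc b)
    have "insert (\<sigma> (Suc b)) (\<sigma> ` {a<..b}) \<in> connected_sets ?G"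
    proof (cases "a = b")
      case True
      then show ?thesis using building_set_singleton[OF bs] by simp
    next
      case False
      have "{\<sigma> b, \<sigma> (Suc b)} \<in> connected_sets ?G"
      proof (rule edge_in_connected_sets)
        show "{\<sigma> b, \<sigma> (Suc b)} \<in> edges ?G"
          unfolding path_graph_relabel_edges using Suc.prems False by (intro CollectI exI[of _ b]) auto
      qed (simp_all add: verts)
      moreover have "\<sigma> ` {a<..b} \<in> connected_sets ?G" using Suc False by simp
      moreover have "\<sigma> b \<in> \<sigma> ` {a<..b}" using Suc.prems False by (intro imageI) simp
      ultimately have "{\<sigma> b, \<sigma> (Suc b)} \<union> \<sigma> ` {a<..b} \<in> connected_sets ?G"
        by (intro building_set_Un[OF bs]) blast+
      moreover have "{\<sigma> b, \<sigma> (Suc b)} \<union> \<sigma> ` {a<..b} = insert (\<sigma> (Suc b)) (\<sigma> ` {a<..b})"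
        using \<open>\<sigma> b \<in> _\<close> by blast
      ultimately show ?thesis by simp
    qed
    moreover have "{a<..Suc b} = insert (Suc b) {a<..b}" using Suc.prems by auto
    ultimately show ?case by simp
  qed simp
  moreover have "\<exists>a b. I = \<sigma> ` {a<..b} \<and> a < b \<and> b \<le> n" if I: "I \<in> connected_sets ?G" for I
  proof -
    define J where "J = {i \<in> {1..n}. \<sigma> i \<in> I}"
    have IJ: "I = \<sigma> ` J"
    proof (intro equalityI subsetI)
      fix v assume "v \<in> I"
      moreover have "v \<in> \<sigma> ` {1..n}" using surj by simp
      ultimately show "v \<in> \<sigma> ` J" by (force simp: J_def)
    qed (auto simp: J_def)
    have "J \<noteq> {}" using building_set_nonempty[OF bs I] IJ by auto
    have fin: "finite J" by (simp add: J_def)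
    have injJ: "inj_on \<sigma> J" using inj by (rule inj_on_subset) (auto simp: J_def)
    have mem: "i \<in> J" if "i \<in> {1..n}" "\<sigma> i \<in> I" for i using that by (simp add: J_def)
    have interior: "m \<in> J" if m: "Min J < m" "m < Max J" for m
    proof (rule ccontr)
      assume "m \<notin> J"
      define S where "S = \<sigma> ` {i \<in> J. i < m}"
      have S_iff: "\<sigma> j \<in> S \<longleftrightarrow> j < m" if "j \<in> J" for j
        using inj_on_image_mem_iff[OF injJ that, of "{i \<in> J. i < m}"] that by (auto simp: S_def)
      have "S \<noteq> {}" using m Min_in[OF fin \<open>J \<noteq> {}\<close>] by (auto simp: S_def)
      moreover have "\<sigma> (Max J) \<notin> S" using S_iff[OF Max_in[OF fin \<open>J \<noteq> {}\<close>]] m by simp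
      then have "S \<subset> I" using IJ Max_in[OF fin \<open>J \<noteq> {}\<close>] by (auto simp: S_def)
      ultimately obtain e where e: "e \<in> edges ?G" "e \<subseteq> I" "e \<inter> S \<noteq> {}" "\<not> e \<subseteq> S"
        using connected_sets_edge_across_cut[OF I] by metis
      then obtain i where i: "e = {\<sigma> i, \<sigma> (Suc i)}" "1 \<le> i" "i < n"
        unfolding path_graph_relabel_edges by blast
      then have iJ: "i \<in> J" "Suc i \<in> J" using e(2) by (auto intro!: mem)
      have "i < m" "\<not> Suc i < m" using e(3,4) i(1) S_iff[OF iJ(1)] S_iff[OF iJ(2)] by auto
      then have "m = Suc i" by simp
      then show False using iJ \<open>m \<notin> J\<close> by simp
    qed
    have "i \<in> J" if "Min J \<le> i" "i \<le> Max J" for i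
    proof (cases "i = Min J \<or> i = Max J")
      case True
      then show ?thesis using Min_in[OF fin \<open>J \<noteq> {}\<close>] Max_in[OF fin \<open>J \<noteq> {}\<close>] by (elim disjE) simp_all
    next
      case False
      then show ?thesis using that by (intro interior) linarith+
    qed
    then have "J \<supseteq> {Min J..Max J}" by auto
    moreover have "J \<subseteq> {Min J..Max J}" using fin by auto
    ultimately have "J = {Min J..Max J}" by (rule equalityI[rotated])
    moreover have "1 \<le> Min J" "Max J \<le> n" "Min J \<le> Max J"
      using Min_in[OF fin \<open>J \<noteq> {}\<close>] Max_in[OF fin \<open>J \<noteq> {}\<close>] fin by (auto simp: J_def)
    moreover have "{Min J - 1<..Max J} = {Min J..Max J}" using \<open>1 \<le> Min J\<close> by auto
    ultimately show ?thesis using IJ by (intro exI[of _ "Min J - 1"] exI[of _ "Max J"]) auto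
  qed
  ultimately show ?thesis by blast
qed

text \<open>In the partial sums \<open>s 0, \<dots>, s n\<close> along the path, the hyperplanes become \<open>s a = s b\<close>, so a chamber is
a linear order of these \<open>n + 1\<close> quantities (this is the braid arrangement). The order is determined by the \<open>n\<close>
comparisons of consecutive elements, and these are the walls.\<close>

lemma simplicial_path_graph:
  fixes \<sigma> :: "nat \<Rightarrow> 'n::finite"
  assumes \<sigma>: "bij_betw \<sigma> {1..CARD('n)} UNIV"
  shows "simplicial_arrangement (hypersubgraph_arrangement (relabel \<sigma> (path_graph CARD('n))))"
proof -
  let ?n = "CARD('n)"
  define F where "F = connected_sets (relabel \<sigma> (path_graph ?n))"
  have F: "F = {\<sigma> ` {a<..b} | a b. a < b \<and> b \<le> ?n}"
    unfolding F_def by (rule connected_sets_path_graph[OF \<sigma>])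
  have single: "\<forall>i. {i} \<in> F"
    using building_set_singleton[OF building_set_connected_sets[OF verts_relabel_path_graph[OF \<sigma>]]]
    by (simp add: F_def)
  define s where "s k y = (\<Sum>i\<in>{0<..k}. y $ \<sigma> i)" for k and y :: "real ^ 'n"
  have diff: "coord_sum (\<sigma> ` {a<..b}) y = s b y - s a y" if "a \<le> b" "b \<le> ?n" for a b y
  proof -
    have "inj_on \<sigma> {a<..b}"
      using \<sigma> that by (auto simp: bij_betw_def intro: inj_on_subset)
    then have "coord_sum (\<sigma> ` {a<..b}) y = (\<Sum>i\<in>{a<..b}. y $ \<sigma> i)"
      by (simp add: coord_sum_def sum.reindex)
    moreover have "{0<..b} = {0<..a} \<union> {a<..b}" using that by auto
    then have "s b y = s a y + (\<Sum>i\<in>{a<..b}. y $ \<sigma> i)"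
      unfolding s_def by (simp add: sum.union_disjoint)
    ultimately show ?thesis by simp
  qed
  define between where "between a b = \<sigma> ` {min a b<..max a b}" for a b
  have between: "coord_sum (between a b) x * coord_sum (between a b) y = (s b x - s a x) * (s b y - s a y)"
    if "a \<le> ?n" "b \<le> ?n" for a b x y
    using that by (cases "a \<le> b") (auto simp: between_def diff algebra_simps)
  have between_mem: "between a b \<in> F" if "a \<le> ?n" "b \<le> ?n" "a \<noteq> b" for a b
  proof -
    have "min a b < max a b" "max a b \<le> ?n" using that by auto
    then show ?thesis unfolding between_def F by blast
  qed
  show ?thesis
    unfolding hypersubgraph_arrangement_eq F_def[symmetric]
  proof (rule simplicial_arrangementI[OF single])
    fix x :: "real ^ 'n" assume gen: "\<forall>I\<in>F. coord_sum I x \<noteq> 0"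
    let ?V = "{..?n}"
    have s_inj: "s a x \<noteq> s b x" if "a \<le> ?n" "b \<le> ?n" "a \<noteq> b" for a b
    proof -
      have "coord_sum (between a b) x \<noteq> 0" using between_mem[OF that] gen by blast
      then show ?thesis using between[OF that(1,2), of x x] by auto
    qed
    have "\<exists>m. is_arg_min (\<lambda>a. - s a x) (\<lambda>a. a \<in> ?V) m"
      by (rule ex_is_arg_min_if_finite) auto
    then obtain m where m: "m \<le> ?n" "\<And>a. a \<le> ?n \<Longrightarrow> s a x \<le> s m x"
      by (auto simp: is_arg_min_linorder)
    have "\<exists>b. b \<le> ?n \<and> s a x < s b x \<and> (\<forall>c\<le>?n. s a x < s c x \<longrightarrow> s b x \<le> s c x)"
      if "a \<le> ?n" "a \<noteq> m" for a
    proof -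
      have "m \<in> {b \<in> ?V. s a x < s b x}" using m s_inj[of a m] that by (auto simp: less_le)
      then have "\<exists>b. is_arg_min (\<lambda>b. s b x) (\<lambda>b. b \<in> {b \<in> ?V. s a x < s b x}) b"
        by (intro ex_is_arg_min_if_finite) auto
      then show ?thesis by (auto simp: is_arg_min_linorder)
    qed
    \<comment> \<open>\<open>m\<close> has the largest partial sum at \<open>x\<close>, and \<open>nxt a\<close> comes directly after \<open>a\<close> in the order.\<close>
    then obtain nxt where nxt: "\<And>a. a \<le> ?n \<Longrightarrow> a \<noteq> m \<Longrightarrow> nxt a \<le> ?n"
      "\<And>a. a \<le> ?n \<Longrightarrow> a \<noteq> m \<Longrightarrow> s a x < s (nxt a) x"
      "\<And>a c. a \<le> ?n \<Longrightarrow> a \<noteq> m \<Longrightarrow> c \<le> ?n \<Longrightarrow> s a x < s c x \<Longrightarrow> s (nxt a) x \<le> s c x"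
      by metis
    define B where "B = (\<lambda>a. between a (nxt a)) ` (?V - {m})"
    have "B \<subseteq> F"
    proof
      fix I assume "I \<in> B"
      then obtain a where a: "a \<le> ?n" "a \<noteq> m" "I = between a (nxt a)" by (auto simp: B_def)
      then have "a \<noteq> nxt a" using nxt(2)[of a] by auto
      then show "I \<in> F" using a nxt(1)[of a] between_mem[of a "nxt a"] by simp
    qed
    moreover have "card B \<le> ?n"
    proof -
      have "card B \<le> card (?V - {m})" unfolding B_def by (rule card_image_le) simp
      also have "\<dots> = ?n" using m(1) by simp
      finally show ?thesis .
    qed
    moreover have "y \<in> cell F x" if y: "\<forall>J\<in>B. 0 < coord_sum J x * coord_sum J y" for y
    proof -
      have step: "s a y < s (nxt a) y" if a: "a \<le> ?n" "a \<noteq> m" for a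
      proof -
        have "0 < coord_sum (between a (nxt a)) x * coord_sum (between a (nxt a)) y"
          using y a unfolding B_def by blast
        then have "0 < (s (nxt a) x - s a x) * (s (nxt a) y - s a y)"
          using between[OF a(1) nxt(1)[OF a]] by simp
        then show ?thesis using nxt(2)[OF a] by (simp add: zero_less_mult_iff)
      qed
      have mono: "s a y < s b y" if "a \<le> ?n" "b \<le> ?n" "s a x < s b x" for a b
        using that
      proof (induction "card {c \<in> ?V. s a x < s c x}" arbitrary: a rule: less_induct)
        case less
        have am: "a \<noteq> m" using less.prems m(2)[of b] by auto
        note na = nxt[OF less.prems(1) am]
        show ?case
        proof (cases "nxt a = b")
          case True
          then show ?thesis using step[OF less.prems(1) am] by simp
        next
          case False
          have lt: "s (nxt a) x < s b x"
            using na(3)[OF less.prems(2,3)] s_inj[OF na(1) less.prems(2) False] by simp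
          have "{c \<in> ?V. s (nxt a) x < s c x} \<subset> {c \<in> ?V. s a x < s c x}"
          proof
            show "{c \<in> ?V. s (nxt a) x < s c x} \<subseteq> {c \<in> ?V. s a x < s c x}" using na(2) by auto
            have "nxt a \<in> {c \<in> ?V. s a x < s c x} - {c \<in> ?V. s (nxt a) x < s c x}" using na(1,2) by simp
            then show "{c \<in> ?V. s (nxt a) x < s c x} \<noteq> {c \<in> ?V. s a x < s c x}" by blast
          qed
          then have "card {c \<in> ?V. s (nxt a) x < s c x} < card {c \<in> ?V. s a x < s c x}"
            by (intro psubset_card_mono) auto
          then have "s (nxt a) y < s b y" using less.hyps na(1) less.prems(2) lt by blast
          then show ?thesis using step[OF less.prems(1) am] by simp
        qed
      qed
      show ?thesis
        unfolding cell_def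
      proof (intro CollectI ballI)
        fix I assume "I \<in> F"
        then obtain a b where I: "I = \<sigma> ` {a<..b}" "a < b" "b \<le> ?n" by (auto simp: F)
        have "s a x < s b x \<or> s b x < s a x" using s_inj[of a b] I by auto
        then have "0 < (s b x - s a x) * (s b y - s a y)"
          using mono[of a b] mono[of b a] I by (auto simp: zero_less_mult_iff)
        then show "0 < coord_sum I x * coord_sum I y" using I by (simp add: diff)
      qed
    qed
    ultimately show "\<exists>B\<subseteq>F. card B \<le> ?n \<and>
        (\<forall>y. (\<forall>J\<in>B. 0 < coord_sum J x * coord_sum J y) \<longrightarrow> y \<in> cell F x)"
      by blast
  qed
qed

text \<open>Up to a permutation and a global sign, two coordinates are positive. Each of the remaining sign
patterns has three of the seven sums as walls, and the other sums, with their signs, are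
nonnegative combinations of these three.\<close>

lemma cell_three_coordinates_two_positive:
  fixes x :: "real ^ 'n::finite"
  assumes ijk: "distinct [i, j, k]" "UNIV = {i, j, k}" and F: "F = {I. I \<noteq> {}}"
    and gen: "\<forall>I\<in>F. coord_sum I x \<noteq> 0" and pos: "x $ i > 0" "x $ j > 0"
  shows "\<exists>B\<subseteq>F. card B \<le> 3 \<and> (\<forall>y. (\<forall>J\<in>B. 0 < coord_sum J x * coord_sum J y) \<longrightarrow> y \<in> cell F x)"
proof -
  have seven: "F = {{i}, {j}, {k}, {i, j}, {i, k}, {j, k}, {i, j, k}}"
  proof -
    have "F = Pow {i, j, k} - {{}}" unfolding F ijk(2)[symmetric] by auto
    then show ?thesis unfolding Pow_insert Pow_empty by auto
  qed
  have sums: "coord_sum {i, j} y = y $ i + y $ j" "coord_sum {i, k} y = y $ i + y $ k"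
    "coord_sum {j, k} y = y $ j + y $ k" "coord_sum {i, j, k} y = y $ i + y $ j + y $ k" for y
    using ijk(1) by (simp_all add: coord_sum_def)
  have cell: "y \<in> cell F x \<longleftrightarrow> 0 < x $ i * y $ i \<and> 0 < x $ j * y $ j \<and> 0 < x $ k * y $ k \<and>
      0 < (x $ i + x $ j) * (y $ i + y $ j) \<and> 0 < (x $ i + x $ k) * (y $ i + y $ k) \<and>
      0 < (x $ j + x $ k) * (y $ j + y $ k) \<and>
      0 < (x $ i + x $ j + x $ k) * (y $ i + y $ j + y $ k)" for y
    unfolding cell_def seven by (simp add: sums)
  have "{k} \<in> F" "{i, k} \<in> F" "{j, k} \<in> F" "{i, j, k} \<in> F" by (simp_all add: F)
  then have nz: "x $ k \<noteq> 0" "x $ i + x $ k \<noteq> 0" "x $ j + x $ k \<noteq> 0" "x $ i + x $ j + x $ k \<noteq> 0"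
    using gen by (force simp: sums)+
  have walls: "\<exists>B\<subseteq>F. card B \<le> 3 \<and> (\<forall>y. (\<forall>J\<in>B. 0 < coord_sum J x * coord_sum J y) \<longrightarrow> y \<in> cell F x)"
    if "I1 \<noteq> {}" "I2 \<noteq> {}" "I3 \<noteq> {}" "\<And>y. 0 < coord_sum I1 x * coord_sum I1 y \<Longrightarrow>
      0 < coord_sum I2 x * coord_sum I2 y \<Longrightarrow> 0 < coord_sum I3 x * coord_sum I3 y \<Longrightarrow> y \<in> cell F x"
    for I1 I2 I3
    using that by (intro exI[of _ "{I1, I2, I3}"]) (auto simp: F card_insert_if)
  consider "x $ k > 0" | "x $ i + x $ j + x $ k < 0"
    | "x $ k < 0" "x $ i + x $ k > 0" "x $ j + x $ k > 0"
    | "x $ k < 0" "x $ i + x $ k > 0" "x $ j + x $ k < 0"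
    | "x $ k < 0" "x $ i + x $ k < 0" "x $ j + x $ k > 0"
    | "x $ i + x $ k < 0" "x $ j + x $ k < 0" "x $ i + x $ j + x $ k > 0"
    using nz by linarith
  then show ?thesis
  proof cases
    case 1
    then show ?thesis using pos by (intro walls[of "{i}" "{j}" "{k}"]) (auto simp: cell sums zero_less_mult_iff)
  next
    case 2
    then show ?thesis using pos by (intro walls[of "{i}" "{j}" "{i, j, k}"]) (auto simp: cell sums zero_less_mult_iff)
  next
    case 3
    then show ?thesis using pos by (intro walls[of "{k}" "{i, k}" "{j, k}"]) (auto simp: cell sums zero_less_mult_iff)
  next
    case 4
    then show ?thesis using pos by (intro walls[of "{j}" "{i, k}" "{j, k}"]) (auto simp: cell sums zero_less_mult_iff)
  next
    case 5
    then show ?thesis using pos by (intro walls[of "{i}" "{i, k}" "{j, k}"]) (auto simp: cell sums zero_less_mult_iff)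
  next
    case 6
    then show ?thesis using pos by (intro walls[of "{i, k}" "{j, k}" "{i, j, k}"]) (auto simp: cell sums zero_less_mult_iff)
  qed
qed

lemma simplicial_three_coordinates:
  fixes F :: "'n::finite set set"
  assumes three: "CARD('n) = 3" and F: "F = {I. I \<noteq> {}}"
  shows "simplicial_arrangement (hyperplane ` F)"
proof (rule simplicial_arrangementI)
  show "\<forall>i. {i} \<in> F" by (simp add: F)
  fix x :: "real ^ 'n" assume gen: "\<forall>I\<in>F. coord_sum I x \<noteq> 0"
  obtain a b c :: 'n where "UNIV = {a, b, c}" "a \<noteq> b" "b \<noteq> c" "a \<noteq> c"
    using three by (auto simp: card_3_iff)
  moreover have "x $ i \<noteq> 0" for i using gen by (auto simp: F dest: bspec[of _ _ "{i}"])
  ultimately obtain i j k where ijk: "distinct [i, j, k]" "UNIV = {i, j, k}" and same: "0 < x $ i * x $ j"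
  proof -
    assume abc: "UNIV = {a, b, c}" "a \<noteq> b" "b \<noteq> c" "a \<noteq> c" and nz: "\<And>i. x $ i \<noteq> 0"
    have "0 < x $ a * x $ b \<or> 0 < x $ a * x $ c \<or> 0 < x $ b * x $ c"
      using nz[of a] nz[of b] nz[of c] by (auto simp: zero_less_mult_iff linorder_neq_iff)
    moreover have "UNIV = {a, c, b}" "UNIV = {b, c, a}" using abc(1) by auto
    ultimately show ?thesis using abc that[of a b c] that[of a c b] that[of b c a] by auto
  qed
  from same consider "x $ i > 0" "x $ j > 0" | "(- x) $ i > 0" "(- x) $ j > 0"
    by (auto simp: zero_less_mult_iff)
  then show "\<exists>B\<subseteq>F. card B \<le> CARD('n) \<and>
      (\<forall>y. (\<forall>J\<in>B. 0 < coord_sum J x * coord_sum J y) \<longrightarrow> y \<in> cell F x)"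
  proof cases
    case 1
    then show ?thesis using cell_three_coordinates_two_positive[OF ijk F gen] three by simp
  next
    case 2
    have neg: "coord_sum I (- y) = - coord_sum I y" for I and y :: "real ^ 'n"
      by (simp add: coord_sum_linear_simps)
    have "\<forall>I\<in>F. coord_sum I (- x) \<noteq> 0" using gen by (simp add: neg)
    from cell_three_coordinates_two_positive[OF ijk F this 2]
    obtain B where B: "B \<subseteq> F" "card B \<le> 3"
      and det: "\<And>y. \<forall>J\<in>B. 0 < coord_sum J (- x) * coord_sum J y \<Longrightarrow> y \<in> cell F (- x)" by blast
    have "y \<in> cell F x" if "\<forall>J\<in>B. 0 < coord_sum J x * coord_sum J y" for y
      using det[of "- y"] that by (simp add: neg cell_def)
    then show ?thesis using B three by auto
  qed
qed

lemma connected_sets_C3: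
  fixes \<sigma> :: "nat \<Rightarrow> 'a::finite"
  assumes \<sigma>: "bij_betw \<sigma> {1..3} UNIV"
  shows "connected_sets (relabel \<sigma> C3) = {I. I \<noteq> {}}"
proof -
  let ?G = "relabel \<sigma> C3"
  have verts: "verts ?G = UNIV" by (rule verts_relabel_C3[OF \<sigma>])
  note bs = building_set_connected_sets[OF verts]
  have pair: "{a, b} \<in> connected_sets ?G" if "a \<noteq> b" for a b
  proof (rule edge_in_connected_sets)
    have "{1..3} = {1, 2, 3::nat}" by auto
    then have "\<sigma> ` {1, 2, 3} = UNIV" using \<sigma> unfolding bij_betw_def by metis
    then have "a \<in> {\<sigma> 1, \<sigma> 2, \<sigma> 3}" "b \<in> {\<sigma> 1, \<sigma> 2, \<sigma> 3}" by auto
    then show "{a, b} \<in> edges ?G"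
      using that unfolding C3_relabel_edges by (elim insertE emptyE) (simp_all add: insert_commute)
  qed (simp_all add: verts)
  have "I \<in> connected_sets ?G" if "I \<noteq> {}" for I
  proof (rule building_set_of_pairs_across_cuts[OF bs that])
    fix S assume "S \<noteq> {}" "S \<subset> I"
    then obtain a b where "a \<in> S" "b \<in> I - S" by blast
    moreover from this have "{a, b} \<in> connected_sets ?G" by (intro pair) blast
    ultimately show "\<exists>a\<in>S. \<exists>b\<in>I - S. {a, b} \<in> connected_sets ?G" by blast
  qed
  then show ?thesis using building_set_nonempty[OF bs] by blast
qed

section \<open>The characterization\<close>

theorem theorem1p5:
  fixes G :: "'n::finite hypergraph"
  assumes "simple_hypergraph G"
    and "verts G = UNIV"
    and "hypergraph_connected G"
  shows "(simplicial_arrangement (hypersubgraph_arrangement G) \<longleftrightarrow>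
            (CARD('n) = 3 \<and> (\<exists>\<sigma>. bij_betw \<sigma> {1..CARD('n)} (UNIV :: 'n set) \<and>
               hypersubgraph_arrangement G = hypersubgraph_arrangement (relabel \<sigma> C3))) \<or>
            (\<exists>\<sigma>. bij_betw \<sigma> {1..CARD('n)} (UNIV :: 'n set) \<and>
               hypersubgraph_arrangement G =
                 hypersubgraph_arrangement (relabel \<sigma> (path_graph CARD('n)))))
       \<and> (simplicial_arrangement (hypersubgraph_arrangement G) \<longleftrightarrow>
            (CARD('n) = 3 \<and> (\<exists>\<sigma>. bij_betw \<sigma> {1..CARD('n)} (UNIV :: 'n set) \<and>
               index_family (hypersubgraph_arrangement G) =
                 index_family (hypersubgraph_arrangement (relabel \<sigma> C3)))) \<or>
            (\<exists>\<sigma>. bij_betw \<sigma> {1..CARD('n)} (UNIV :: 'n set) \<and>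
               index_family (hypersubgraph_arrangement G) =
                 index_family (hypersubgraph_arrangement (relabel \<sigma> (path_graph CARD('n))))))"
proof -
  let ?F = "connected_sets G"
  have "induced G UNIV = G"
    unfolding induced_def using assms(2) by (simp add: prod_eq_iff)
  then have univ: "UNIV \<in> ?F"
    using assms(2,3) by (simp add: connected_sets_def)
  have "(simplicial_arrangement (hypersubgraph_arrangement G) \<longleftrightarrow>
            (CARD('n) = 3 \<and> (\<exists>\<sigma>. bij_betw \<sigma> {1..CARD('n)} (UNIV :: 'n set) \<and>
               hypersubgraph_arrangement G = hypersubgraph_arrangement (relabel \<sigma> C3))) \<or>
            (\<exists>\<sigma>. bij_betw \<sigma> {1..CARD('n)} (UNIV :: 'n set) \<and>
               hypersubgraph_arrangement G =
                 hypersubgraph_arrangement (relabel \<sigma> (path_graph CARD('n)))))"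
    (is "?simp \<longleftrightarrow> ?C3 \<or> ?path")
  proof (intro iffI)
    assume ?simp
    then obtain \<sigma> where \<sigma>: "bij_betw \<sigma> {1..CARD('n)} (UNIV :: 'n set)"
      and "?F = connected_sets (relabel \<sigma> (path_graph CARD('n))) \<or>
        (CARD('n) = 3 \<and> ?F = connected_sets (relabel \<sigma> C3))"
      using simplicial_imp_path_or_C3[OF building_set_connected_sets[OF assms(2)] univ]
      unfolding hypersubgraph_arrangement_eq by metis
    then show "?C3 \<or> ?path" unfolding hypersubgraph_arrangement_eq by metis
  next
    assume "?C3 \<or> ?path"
    then show ?simp
    proof
      assume ?C3
      then show ?simp
        using simplicial_three_coordinates connected_sets_C3
        unfolding hypersubgraph_arrangement_eq by metis
    next
      assume ?path
      then show ?simp using simplicial_path_graph by metis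
    qed
  qed
  then show ?thesis unfolding index_family_eq_iff by blast
qed

end
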